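(* Let $k\ge a\ge1$ be integers and let $H_{k,a}(n)$ be the number of lattice paths (as described in the context) satisfying the special $(k,a)$-conditions, with major index $n$, all of whose peaks have even parity. Then \[ \sum_{n\ge0}H_{k,a}(n)q^n=\sum_{n_1,\ldots,n_{k-1}\ge0}\frac{q^{N_1(N_1+1)/2+N_2^2+\cdots+N_{k-1}^2+\sum_{j\ge0,\ a+1+2j\le k-1}2N_{a+1+2j}}\,(-q)_{N_1}}{(q^2;q^2)_{n_1}\cdots(q^2;q^2)_{n_{k-1}}}, \] where $N_i=n_i+n_{i+1}+\cdots+n_{k-1}$ for $1\le i\le k-1$.
   Context: Notation: $(a;q)_n=\prod_{i=0}^{n-1}(1-aq^i)$, $(a)_n=(a;q)_n$. Lattice paths: paths in the first quadrant starting on the $y$-axis and ending on the $x$-axis, using unit steps NE $(x,y)\to(x+1,y+1)$, SE $(x,y)\to(x+1,y-1)$, N $(x,y-1)\to(x,y)$, and E $(x,0)\to(x+1,0)$ (E steps only at height $0$). Height = $y$-coordinate, weight = $x$-coordinate. A peak is a vertex preceded by an NE step (NESE peak) or an N step (NSE peak) and followed by an SE step. Paths are empty or end with an SE step; as stated in the paper, if the leftmost peak is an NSE peak, the path must start with an NE step, except when it starts at $(0,0)$ with an E step. Major index = sum of weights of peaks. Special $(k,a)$-conditions: the path starts at height $k-a$ and all heights are $<k$. The relative height of a peak $(x,y)$ is the largest integer $h$ for which there are two vertices $(x',y-h)$ and $(x'',y-h)$ of the path with $x'\le x<x''$ such that between these two vertices there is no peak of height $>y$ and every peak of height $y$ has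 abscissa $\ge x$. $W(x)$ is the number of NSE peaks with weight $\le x$. The parity of a peak $(x,y)$ of relative height $r$ is the opposite of the parity of $x-r-W(x)$ (the peak is even iff $x-r-W(x)$ is odd).
   Formalization: The rule that a path whose leftmost peak is an NSE peak must start with an NE step is read with SE in place of NE (as printed, k=2, a=1, n=1 gives count 0 but right-hand coefficient 1), and every N step is required to be immediately followed by an SE step. *)

theory Defs
  imports
    "HOL-Analysis.Infinite_Sum"
    "HOL-Computational_Algebra.Formal_Power_Series"
begin

section \<open>Lattice paths\<close>

datatype step = NE | SE | North | East

fun apply_step :: "step \<Rightarrow> int \<times> int \<Rightarrow> int \<times> int" where
  "apply_step NE    (x, y) = (x + 1, y + 1)"
| "apply_step SE    (x, y) = (x + 1, y - 1)"
| "apply_step North (x, y) = (x, y + 1)"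
| "apply_step East  (x, y) = (x + 1, y)"

text \<open>A path is given by the height at which it starts on the \<open>y\<close>-axis and its list of steps.
  A vertex is referred to by its position \<open>i\<close> along the path (\<open>0 \<le> i \<le>\<close> number of steps).\<close>

type_synonym lpath = "int \<times> step list"

definition steps :: "lpath \<Rightarrow> step list" where
  "steps P = snd P"

definition start_height :: "lpath \<Rightarrow> int" where
  "start_height P = fst P"

definition vertex :: "lpath \<Rightarrow> nat \<Rightarrow> int \<times> int" where
  "vertex P i = fold apply_step (take i (steps P)) (0, start_height P)"

definition weight :: "lpath \<Rightarrow> nat \<Rightarrow> int" where
  "weight P i = fst (vertex P i)"

definition height :: "lpath \<Rightarrow> nat \<Rightarrow> int" where
  "height P i = snd (vertex P i)"

definition NESE_peak :: "lpath \<Rightarrow> nat \<Rightarrow> bool" where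
  "NESE_peak P i \<longleftrightarrow>
     0 < i \<and> i < length (steps P) \<and> steps P ! (i - 1) = NE \<and> steps P ! i = SE"

definition NSE_peak :: "lpath \<Rightarrow> nat \<Rightarrow> bool" where
  "NSE_peak P i \<longleftrightarrow>
     0 < i \<and> i < length (steps P) \<and> steps P ! (i - 1) = North \<and> steps P ! i = SE"

definition peak :: "lpath \<Rightarrow> nat \<Rightarrow> bool" where
  "peak P i \<longleftrightarrow> NESE_peak P i \<or> NSE_peak P i"

text \<open>A North step only occurs as the ascent of an NSE peak, i.e. it is immediately followed by a
  SE step. The last conjunct is the rule on the leftmost peak. The source prints ``must start with
  a NE step'', but the step meant is SE: with NE, no path could start with a SE step and have an NSE
  peak as leftmost peak, and already for \<open>k = 2\<close>, \<open>a = 1\<close> the path SE, North, SE, of major index 1,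
  which the generating function counts, would be lost.\<close>

definition lattice_path :: "lpath \<Rightarrow> bool" where
  "lattice_path P \<longleftrightarrow>
     (\<forall>i \<le> length (steps P). 0 \<le> height P i) \<and>
     height P (length (steps P)) = 0 \<and>
     (\<forall>i < length (steps P). steps P ! i = East \<longrightarrow> height P i = 0) \<and>
     (\<forall>i < length (steps P). steps P ! i = North \<longrightarrow>
        Suc i < length (steps P) \<and> steps P ! Suc i = SE) \<and>
     (steps P = [] \<or> last (steps P) = SE) \<and>
     (\<forall>i. NSE_peak P i \<and> (\<forall>j < i. \<not> peak P j) \<longrightarrow>
        steps P ! 0 = SE \<or> (start_height P = 0 \<and> steps P ! 0 = East))"

definition special_conditions :: "nat \<Rightarrow> nat \<Rightarrow> lpath \<Rightarrow> bool" where
  "special_conditions k a P \<longleftrightarrow>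
     start_height P = int k - int a \<and> (\<forall>i \<le> length (steps P). height P i < int k)"

definition major_index :: "lpath \<Rightarrow> int" where
  "major_index P = (\<Sum>i | peak P i. weight P i)"

text \<open>``Between'' two vertices refers to the order along the path. The value \<open>h = 1\<close> is always
  admissible for a peak of a lattice path and \<open>h\<close> never exceeds its height, so the greatest
  \<open>h\<close> exists.\<close>

definition relative_height :: "lpath \<Rightarrow> nat \<Rightarrow> int" where
  "relative_height P i = (GREATEST h.
     \<exists>l r. l \<le> length (steps P) \<and> r \<le> length (steps P) \<and>
       height P l = height P i - h \<and> height P r = height P i - h \<and>
       weight P l \<le> weight P i \<and> weight P i < weight P r \<and>
       (\<forall>j. peak P j \<and> l \<le> j \<and> j \<le> r \<longrightarrow>
          \<not> height P j > height P i \<and>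
          (height P j = height P i \<longrightarrow> weight P j \<ge> weight P i)))"

definition NSE_count :: "lpath \<Rightarrow> int \<Rightarrow> nat" where
  "NSE_count P x = card {i. NSE_peak P i \<and> weight P i \<le> x}"

text \<open>The parity of a peak is opposite to that of \<open>x - r - W(x)\<close>.\<close>

definition even_peak :: "lpath \<Rightarrow> nat \<Rightarrow> bool" where
  "even_peak P i \<longleftrightarrow>
     odd (weight P i - relative_height P i - int (NSE_count P (weight P i)))"

text \<open>The set counted here is finite: apart from the final descent, every step ends at or to the
  left of the last peak, whose weight is at most \<open>n\<close>, and no two North steps are adjacent.\<close>

definition H :: "nat \<Rightarrow> nat \<Rightarrow> nat \<Rightarrow> nat" where
  "H k a n = card {P. lattice_path P \<and> special_conditions k a P \<and>
     major_index P = int n \<and> (\<forall>i. peak P i \<longrightarrow> even_peak P i)}"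

section \<open>The multiple series\<close>

definition qpoch :: "'a::comm_ring_1 \<Rightarrow> 'a \<Rightarrow> nat \<Rightarrow> 'a" where
  "qpoch a q n = (\<Prod>i<n. 1 - a * q ^ i)"

definition tail_sum :: "nat \<Rightarrow> (nat \<Rightarrow> nat) \<Rightarrow> nat \<Rightarrow> nat" where
  "tail_sum k n i = (\<Sum>j = i..k - 1. n j)"

end

(* A position i along a path is its abscissa plus the number of North steps before it, so a peak i of
   relative height r is even iff i - r is odd. As in the elder rule of persistent homology, the base
   line of the relative height of a peak passes through a valley at which the path turns up, with no
   East step in between, and every such valley arises from some peak. Hence all peaks are even iff
   the path turns up only at odd positions, which a finite automaton can check. Splitting off first
   steps gives linear q-difference equations, in the number n of peaks and the starting height h, for
   the generating functions. They have a unique solution, and induction on the number of summation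
   variables shows that the multiple sum is this solution: summing out one variable, as in the Bailey
   chain, carries the equations for k to those for k + 1. *)

theory Submission
  imports Defs
begin

section \<open>Recurrences for the multiple series\<close>

text \<open>Write q for \<open>fps_X\<close>. A relative height depends on the whole path, a turn
  only on two steps. The relation \<open>paired\<close> bridges this; it is total on both sides, and
  every pair gives the same equivalence of parities. For a fixed number of peaks the equations link
  heights at distance two and have three forms: at height k - 1 no ascent is possible, at k - 2 an
  ascent has a single step, and below that the general form holds. Summing out a variable raises k
  and keeps the height, so an edge equation turns into a top equation and a top equation into a
  general one; the definition of \<open>multisum\<close> only has to supply the new edge. The path
  series obey the same equations, except that the terms with one peak fewer carry an extra q^n (1 +
  q^(n+1)). The product of these is \<open>factor\<close>, the source of (-q)_(N_1) and of
  N_1(N_1-1)/2. A forced first step from position 0 adds the missing N_1.\<close>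

definition ipoch :: "nat \<Rightarrow> rat fps" where
  "ipoch j = inverse (qpoch (fps_X\<^sup>2) (fps_X\<^sup>2) j)"

lemma ipoch_0 [simp]: "ipoch 0 = 1"
  by (simp add: ipoch_def qpoch_def)

lemma ipoch_Suc: "(1 - fps_X ^ (2 * Suc j)) * ipoch (Suc j) = ipoch j"
proof -
  have "fps_nth (1 - fps_X ^ (2 * Suc j) :: rat fps) 0 \<noteq> 0"
    by simp
  moreover have "qpoch (fps_X\<^sup>2) (fps_X\<^sup>2) (Suc j)
      = (1 - fps_X ^ (2 * Suc j)) * qpoch (fps_X\<^sup>2) (fps_X\<^sup>2 :: rat fps) j"
    by (simp add: qpoch_def mult.commute flip: power_mult power_add)
  ultimately show ?thesis
    by (simp add: ipoch_def fps_inverse_mult inverse_mult_eq_1' flip: mult.assoc)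
qed

text \<open>In the multiple sum \<open>n\<close> is N_s, \<open>m\<close> is N_(s+1) and
  \<open>n - m\<close> is the variable n_s that is summed out.\<close>

definition bailey :: "(nat \<Rightarrow> rat fps) \<Rightarrow> nat \<Rightarrow> rat fps" where
  "bailey f n = (\<Sum>m\<le>n. fps_X ^ m\<^sup>2 * f m * ipoch (n - m))"

lemma bailey_0 [simp]: "bailey f 0 = f 0"
  by (simp add: bailey_def)

text \<open>Termwise: q^(2(n+1)) splits into q^(2m), which turns g into f, and q^(2(n+1-m)), which
  turns \<open>ipoch (n + 1 - m)\<close> into its difference from
  \<open>ipoch (n - m)\<close>.\<close>

lemma bailey_step_top:
  assumes "\<And>m. f m = fps_X ^ (2 * m) * g m"
  shows "bailey f (Suc n) = fps_X ^ (2 * Suc n) * bailey g (Suc n) + bailey f n"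
proof -
  have "fps_X ^ m\<^sup>2 * f m * ipoch (Suc n - m)
      = fps_X ^ (2 * Suc n) * (fps_X ^ m\<^sup>2 * g m * ipoch (Suc n - m))
        + fps_X ^ m\<^sup>2 * f m * ipoch (n - m)" if "m \<le> n" for m
  proof -
    have e: "fps_X ^ (2 * Suc n) = fps_X ^ (2 * Suc (n - m)) * (fps_X ^ (2 * m) :: rat fps)"
      using that by (simp flip: power_add)
    show ?thesis
      using that unfolding e assms[of m] ipoch_Suc[of "n - m", symmetric] Suc_diff_le[OF that]
      by algebra
  qed
  then show ?thesis
    by (simp add: bailey_def sum.distrib sum_distrib_left assms[of "Suc n"] algebra_simps
        flip: assms)
qed

text \<open>Now q^(2m) g(m) is a difference of two values of f. The part with f(m) at its own index
  is \<open>A\<close>; the part with f one index lower is \<open>B\<close>. Since (m+1)^2 + 2(n-m) =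
  m^2 + 2n+1, the index shift in \<open>B\<close> costs exactly the factor q^(2n+1).\<close>

lemma bailey_step_second:
  assumes "f 0 = g 0"
    and "\<And>m. f (Suc m) = fps_X ^ (2 * Suc m) * g (Suc m) + f m"
  shows "bailey f (Suc n) =
    fps_X ^ (2 * Suc n) * bailey g (Suc n) + (1 + fps_X ^ (2 * n + 1)) * bailey f n"
proof -
  define A where "A m = fps_X ^ (m\<^sup>2 + 2 * (Suc n - m)) * f m * ipoch (Suc n - m)" for m
  define B where "B m = fps_X ^ ((Suc m)\<^sup>2 + 2 * (n - m)) * f m * ipoch (n - m)" for m
  define G where "G m = fps_X ^ (2 * Suc n) * (fps_X ^ m\<^sup>2 * g m * ipoch (Suc n - m))" for m
  have G0: "G 0 = A 0"
    using assms(1) by (simp add: G_def A_def algebra_simps)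
  have GS: "G (Suc m) = A (Suc m) - B m" if "m \<le> n" for m
  proof -
    have e: "fps_X ^ (2 * Suc n) = fps_X ^ (2 * (n - m)) * (fps_X ^ (2 * Suc m) :: rat fps)"
      using that by (simp flip: power_add)
    have g: "fps_X ^ (2 * Suc m) * g (Suc m) = f (Suc m) - f m"
      using assms(2)[of m] by simp
    have "G (Suc m) = fps_X ^ (2 * (n - m)) * fps_X ^ (Suc m)\<^sup>2
        * (fps_X ^ (2 * Suc m) * g (Suc m)) * ipoch (n - m)"
      unfolding G_def e by simp
    then show ?thesis
      unfolding g A_def B_def by (simp add: power_add algebra_simps)
  qed
  have "fps_X ^ (2 * Suc n) * bailey g (Suc n) = G 0 + (\<Sum>m\<le>n. G (Suc m))"
    unfolding bailey_def sum_distrib_left G_def[symmetric] by (rule sum.atMost_Suc_shift)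
  also have "\<dots> = (\<Sum>m\<le>Suc n. A m) - (\<Sum>m\<le>n. B m)"
    unfolding sum.atMost_Suc_shift[of A] using G0 GS by (simp add: sum_subtractf)
  finally have *: "fps_X ^ (2 * Suc n) * bailey g (Suc n) = \<dots>" .
  have 1: "fps_X ^ m\<^sup>2 * f m * ipoch (Suc n - m) - A m = fps_X ^ m\<^sup>2 * f m * ipoch (n - m)"
    if "m \<le> n" for m
    using that unfolding A_def ipoch_Suc[of "n - m", symmetric] Suc_diff_le[OF that] power_add
    by algebra
  have 2: "B m = fps_X ^ (2 * n + 1) * (fps_X ^ m\<^sup>2 * f m * ipoch (n - m))" if "m \<le> n" for m
  proof -
    have "(Suc m)\<^sup>2 + 2 * (n - m) = (2 * n + 1) + m\<^sup>2"
      using that by (simp add: power2_eq_square)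
    then show ?thesis unfolding B_def by (simp add: power_add mult.assoc)
  qed
  have "bailey f (Suc n) - (\<Sum>m\<le>Suc n. A m) = bailey f n"
    unfolding bailey_def sum_subtractf[symmetric]
    using 1 by (simp add: A_def)
  moreover have "(\<Sum>m\<le>n. B m) = fps_X ^ (2 * n + 1) * bailey f n"
    using 2 by (simp add: bailey_def sum_distrib_left)
  ultimately show ?thesis
    unfolding * by (simp add: algebra_simps)
qed

text \<open>The coefficient 1 + q^(4m) is what makes the shape reproduce itself: (1 - q^(2(n+1+m)))
  (1 - q^(2(n+1-m))) = 1 + q^(4(n+1)) - q^(2(n+1-m)) (1 + q^(4m)). The second factor lowers the
  index of \<open>ipoch\<close>, and the first, together with the share of \<open>B\<close>, gives 1
  - q^(2(n+m+1)) + q^(2n+1) (1 + q^(2m+1)) = 1 + q^(2n+1).\<close>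

lemma bailey_step_general:
  assumes "g 0 = 2 * f 0"
    and "\<And>m. (1 + fps_X ^ (4 * Suc m)) * f (Suc m) =
      fps_X ^ (2 * Suc m) * g (Suc m) + (1 + fps_X ^ (2 * m + 1)) * f m"
  shows "(1 + fps_X ^ (4 * Suc n)) * bailey f (Suc n) =
    fps_X ^ (2 * Suc n) * bailey g (Suc n) + (1 + fps_X ^ (2 * n + 1)) * bailey f n"
proof -
  define A where "A m = fps_X ^ (m\<^sup>2 + 2 * (Suc n - m)) * (1 + fps_X ^ (4 * m)) * f m * ipoch (Suc n - m)" for m
  define B where "B m = fps_X ^ ((Suc m)\<^sup>2 + 2 * (n - m)) * (1 + fps_X ^ (2 * m + 1)) * f m * ipoch (n - m)" for m
  define G where "G m = fps_X ^ (2 * Suc n) * (fps_X ^ m\<^sup>2 * g m * ipoch (Suc n - m))" for m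
  have G0: "G 0 = A 0"
    using assms(1) by (simp add: G_def A_def algebra_simps)
  have GS: "G (Suc m) = A (Suc m) - B m" if "m \<le> n" for m
  proof -
    have e: "fps_X ^ (2 * Suc n) = fps_X ^ (2 * (n - m)) * (fps_X ^ (2 * Suc m) :: rat fps)"
      using that by (simp flip: power_add)
    have g: "fps_X ^ (2 * Suc m) * g (Suc m) = (1 + fps_X ^ (4 * Suc m)) * f (Suc m)
      - (1 + fps_X ^ (2 * m + 1)) * f m"
      using assms(2)[of m] by (simp only: add_diff_cancel_right')
    have "G (Suc m) = fps_X ^ (2 * (n - m)) * fps_X ^ (Suc m)\<^sup>2
        * (fps_X ^ (2 * Suc m) * g (Suc m)) * ipoch (n - m)"
      unfolding G_def e by simp
    then show ?thesis
      unfolding g A_def B_def power_add diff_Suc_Suc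
      by (simp only: left_diff_distrib right_diff_distrib mult_ac)
  qed
  have "fps_X ^ (2 * Suc n) * bailey g (Suc n) = G 0 + (\<Sum>m\<le>n. G (Suc m))"
    unfolding bailey_def sum_distrib_left G_def[symmetric] by (rule sum.atMost_Suc_shift)
  also have "\<dots> = (\<Sum>m\<le>Suc n. A m) - (\<Sum>m\<le>n. B m)"
    unfolding sum.atMost_Suc_shift[of A] using G0 GS by (simp add: sum_subtractf)
  finally have *: "fps_X ^ (2 * Suc n) * bailey g (Suc n) = \<dots>" .
  have 1: "(1 + fps_X ^ (4 * Suc n)) * (fps_X ^ m\<^sup>2 * f m * ipoch (Suc n - m)) - A m + B m
      = (1 + fps_X ^ (2 * n + 1)) * (fps_X ^ m\<^sup>2 * f m * ipoch (n - m))"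
    if "m \<le> n" for m
  proof -
    have e: "(Suc m)\<^sup>2 + 2 * (n - m) = (2 * n + 1) + m\<^sup>2"
      using that by (simp add: power2_eq_square)
    have p1: "fps_X ^ (4 * Suc n) = fps_X ^ (2 * Suc (n + m)) * (fps_X ^ (2 * Suc (n - m)) :: rat fps)"
      using that by (simp del: power_Suc flip: power_add)
    have p2: "fps_X ^ (2 * Suc (n + m)) = fps_X ^ (2 * Suc (n - m)) * (fps_X ^ (4 * m) :: rat fps)"
      using that by (simp flip: power_add)
    have p3: "fps_X ^ (2 * Suc (n + m)) = fps_X ^ (2 * n + 1) * (fps_X ^ (2 * m + 1) :: rat fps)"
      by (simp flip: power_add)
    have "(1 + fps_X ^ (4 * Suc n)) * (fps_X ^ m\<^sup>2 * f m * ipoch (Suc n - m)) - A m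
      = fps_X ^ m\<^sup>2 * f m * ((1 - fps_X ^ (2 * Suc (n + m))) * ((1 - fps_X ^ (2 * Suc (n - m))) * ipoch (Suc (n - m))))"
      unfolding A_def Suc_diff_le[OF that] p1 power_add[of _ "m\<^sup>2"] unfolding p2 by algebra
    also have "\<dots> = fps_X ^ m\<^sup>2 * f m * ((1 - fps_X ^ (2 * Suc (n + m))) * ipoch (n - m))"
      unfolding ipoch_Suc ..
    finally have eq: "(1 + fps_X ^ (4 * Suc n)) * (fps_X ^ m\<^sup>2 * f m * ipoch (Suc n - m)) - A m = \<dots>" .
    show ?thesis
      unfolding eq B_def e p3 power_add[of _ "2 * n + 1" "m\<^sup>2"] by algebra
  qed
  have "A (Suc n) = (1 + fps_X ^ (4 * Suc n)) * (fps_X ^ (Suc n)\<^sup>2 * f (Suc n) * ipoch (Suc n - Suc n))"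
    by (simp add: A_def algebra_simps)
  then have "(1 + fps_X ^ (4 * Suc n)) * bailey f (Suc n) - (\<Sum>m\<le>Suc n. A m) + (\<Sum>m\<le>n. B m)
    = (\<Sum>m\<le>n. (1 + fps_X ^ (4 * Suc n)) * (fps_X ^ m\<^sup>2 * f m * ipoch (Suc n - m)) - A m + B m)"
    unfolding bailey_def sum_distrib_left sum.distrib sum_subtractf by simp
  also have "\<dots> = (1 + fps_X ^ (2 * n + 1)) * bailey f n"
    unfolding bailey_def sum_distrib_left using 1 by (intro sum.cong) auto
  finally show ?thesis
    unfolding * by (simp add: algebra_simps)
qed

text \<open>For \<open>h \<le> 1\<close> the subtraction truncates; this is intended and encodes the reflection of the
  recurrences at height 0.\<close>

primrec multisum :: "nat \<Rightarrow> nat \<Rightarrow> nat \<Rightarrow> rat fps" where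
  "multisum 0 h n = (if n = 0 then 1 else 0)"
| "multisum (Suc J) h n =
    (if h \<le> J then bailey (multisum J h) n
     else fps_X ^ (2 * n) * bailey (multisum J (h - 2)) n)"

lemma multisum_at_0 [simp]: "multisum J h 0 = 1"
  by (induction J arbitrary: h) auto

lemma multisum_edge: "multisum J J n = fps_X ^ (2 * n) * multisum J (J - 2) n"
  by (cases J) auto

lemma multisum_top:
  "multisum (Suc J) J (Suc n) =
    fps_X ^ (2 * Suc n) * multisum (Suc J) (J - 2) (Suc n) + multisum (Suc J) J n"
  using bailey_step_top[OF multisum_edge] by simp

text \<open>Heights already general for \<open>J\<close> stay so by
  \<open>bailey_step_general\<close>. Otherwise \<open>J = h + 1\<close>: then \<open>h\<close>
  obeys the top equation for \<open>J\<close>, and \<open>h + 2\<close> is the edge height for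
  \<open>Suc J\<close>, so its edge equation turns that neighbour into q^(2(n+1)) times the unknown
  itself. This is the origin of 1 + q^(4(n+1)).\<close>

lemma multisum_general:
  "h + 2 \<le> J \<Longrightarrow>
   (1 + fps_X ^ (4 * Suc n)) * multisum J h (Suc n) =
     fps_X ^ (2 * Suc n) * (multisum J (h - 2) (Suc n) + multisum J (h + 2) (Suc n))
     + (1 + fps_X ^ (2 * n + 1)) * multisum J h n"
proof (induction J arbitrary: h n)
  case (Suc J)
  have add: "bailey f n + bailey g n = bailey (\<lambda>m. f m + g m) n" for f g n
    by (simp add: bailey_def sum.distrib algebra_simps)
  show ?case
  proof (cases "h + 2 \<le> J")
    case True
    then have "h \<le> J" "h - 2 \<le> J" by auto
    with True show ?thesis
      using bailey_step_general[of "\<lambda>m. multisum J (h - 2) m + multisum J (h + 2) m" "multisum J h" n]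
        Suc.IH[OF True] by (simp add: add del: power_Suc)
  next
    case False
    with Suc.prems have h: "J = Suc h" by simp
    have "bailey (multisum J h) (Suc n) = fps_X ^ (2 * Suc n) * bailey (multisum J (h - 2)) (Suc n)
        + (1 + fps_X ^ (2 * n + 1)) * bailey (multisum J h) n"
      by (rule bailey_step_second) (auto simp: h multisum_top simp del: multisum.simps)
    moreover have "fps_X ^ (2 * Suc n) * multisum (Suc J) (h + 2) (Suc n)
       = fps_X ^ (4 * Suc n) * bailey (multisum J h) (Suc n)"
      proof -
      have "fps_X ^ (4 * Suc n) = fps_X ^ (2 * Suc n) * (fps_X ^ (2 * Suc n) :: rat fps)"
        by (simp del: power_Suc flip: power_add)
      then show ?thesis using h by (simp add: mult.assoc del: power_Suc)
    qed
    moreover have "multisum (Suc J) h = bailey (multisum J h)"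
        "multisum (Suc J) (h - 2) = bailey (multisum J (h - 2))"
      using h by auto
    ultimately show ?thesis
      unfolding distrib_left by (simp only: distrib_right mult_1_left add_ac)
  qed
qed simp

section \<open>Pairing peaks with upturns\<close>

text \<open>Position 0 counts as entered by a SE step, so a path that starts upwards has an upturn
  at the even position 0.\<close>

definition entry :: "step list \<Rightarrow> nat \<Rightarrow> step" where
  "entry w i = (if i = 0 then SE else w ! (i - 1))"

definition upturn :: "step list \<Rightarrow> nat \<Rightarrow> bool" where
  "upturn w i \<longleftrightarrow> i < length w \<and> w ! i \<in> {NE, North} \<and> entry w i \<in> {SE, East}"

section \<open>Positions, abscissae and heights along a path\<close>

lemma vertex_0: "vertex P 0 = (0, start_height P)"
  by (simp add: vertex_def)

lemma vertex_Suc: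
  "i < length (steps P) \<Longrightarrow> vertex P (Suc i) = apply_step (steps P ! i) (vertex P i)"
  by (simp add: vertex_def take_Suc_conv_app_nth)

lemma weight_0 [simp]: "weight P 0 = 0"
  and height_0 [simp]: "height P 0 = start_height P"
  by (simp_all add: weight_def height_def vertex_0)

lemma weight_Suc:
  "i < length (steps P) \<Longrightarrow>
   weight P (Suc i) = weight P i + (if steps P ! i = North then 0 else 1)"
  by (cases "vertex P i"; cases "steps P ! i") (auto simp: weight_def vertex_Suc)

lemma height_Suc:
  "i < length (steps P) \<Longrightarrow>
   height P (Suc i) = height P i +
     (case steps P ! i of NE \<Rightarrow> 1 | SE \<Rightarrow> -1 | North \<Rightarrow> 1 | East \<Rightarrow> 0)"
  by (cases "vertex P i"; cases "steps P ! i") (auto simp: height_def vertex_Suc)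

lemma weight_mono: "i \<le> j \<Longrightarrow> j \<le> length (steps P) \<Longrightarrow> weight P i \<le> weight P j"
  by (induction j rule: dec_induct) (auto simp: weight_Suc)

lemma index_eq_weight_plus_North:
  "i \<le> length (steps P) \<Longrightarrow> weight P i + int (card {t. t < i \<and> steps P ! t = North}) = int i"
proof (induction i)
  case (Suc i)
  have "{t. t < Suc i \<and> steps P ! t = North}
      = (if steps P ! i = North then insert i else id) {t. t < i \<and> steps P ! t = North}"
    by (auto simp: less_Suc_eq)
  then show ?case
    using Suc by (auto simp: weight_Suc)
qed simp

lemma peak_iff: "peak P i \<longleftrightarrow>
    i < length (steps P) \<and> steps P ! i = SE \<and> entry (steps P) i \<in> {NE, North}"
  by (auto simp: peak_def NESE_peak_def NSE_peak_def entry_def)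

lemma peak_weight_less:
  assumes "peak P i" "i < j" "j \<le> length (steps P)"
  shows "weight P i < weight P j"
proof -
  have "weight P i < weight P (Suc i)"
    using assms by (simp add: weight_Suc peak_iff)
  also have "\<dots> \<le> weight P j"
    using assms by (intro weight_mono) auto
  finally show ?thesis .
qed

lemma peak_weight_le_iff:
  assumes "peak P i" "j \<le> length (steps P)"
  shows "weight P j \<le> weight P i \<longleftrightarrow> j \<le> i"
  using peak_weight_less[OF assms(1), of j] weight_mono[of j i P] assms
  by (force simp: peak_iff not_le[symmetric])

lemma peak_weight_ge_iff:
  assumes "peak P j" "i \<le> length (steps P)"
  shows "weight P i \<le> weight P j \<longleftrightarrow> i \<le> j"
  using peak_weight_le_iff[OF assms] .

text \<open>For the pairing, North and NE are alike: only the sequence of heights counts, with level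
  steps confined to the ground.\<close>

locale mountain_path =
  fixes P :: lpath and L :: nat and h :: "nat \<Rightarrow> int"
  defines L_def: "L \<equiv> length (steps P)" and h_def: "h \<equiv> height P"
  assumes nonneg: "i \<le> L \<Longrightarrow> 0 \<le> h i"
    and ends_at_0: "h L = 0"
    and East_at_0: "i < L \<Longrightarrow> steps P ! i = East \<Longrightarrow> h i = 0"
begin

lemma h_Suc: "i < L \<Longrightarrow>
   h (Suc i) = h i + (case steps P ! i of NE \<Rightarrow> 1 | SE \<Rightarrow> -1 | North \<Rightarrow> 1 | East \<Rightarrow> 0)"
  unfolding h_def L_def by (rule height_Suc)

lemma h_step: "i < L \<Longrightarrow> \<bar>h (Suc i) - h i\<bar> \<le> 1"
  by (simp add: h_Suc split: step.split)

lemma crosses_up: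
  assumes "l \<le> r" "r \<le> L" "h l \<le> c" "c \<le> h r"
  obtains i where "l \<le> i" "i \<le> r" "h i = c"
  using nat_intermed_int_val[of l r h c] h_step assms by (meson le_trans less_le_trans)

lemma crosses_down:
  assumes "l \<le> r" "r \<le> L" "c \<le> h l" "h r \<le> c"
  obtains i where "l \<le> i" "i \<le> r" "h i = c"
proof -
  have "\<bar>- h (Suc i) - - h i\<bar> \<le> 1" if "i < r" for i
    using h_step[of i] that assms by auto
  then have "\<exists>i. l \<le> i \<and> i \<le> r \<and> - h i = - c"
    using nat_intermed_int_val[of l r "\<lambda>i. - h i" "- c"] assms by simp
  then show ?thesis using that by auto
qed

lemma ascent_step:
  assumes "i < L" "h i < h (Suc i)" shows "steps P ! i \<in> {NE, North}" "h (Suc i) = h i + 1"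
  using assms by (auto simp: h_Suc split: step.splits)

lemma peak_h:
  assumes "peak P i" shows "i < L" "0 < i" "h (Suc i) = h i - 1" "h (i - 1) = h i - 1"
proof -
  show i: "i < L" "0 < i"
    using assms by (auto simp: peak_iff L_def entry_def split: if_splits)
  then show "h (Suc i) = h i - 1"
    using assms by (simp add: h_Suc peak_iff)
  show "h (i - 1) = h i - 1"
    using assms i h_Suc[of "i - 1"] by (auto simp: peak_iff entry_def)
qed

lemma upturn_h:
  assumes "upturn (steps P) v" shows "v < L" "h (Suc v) = h v + 1"
  using assms h_Suc[of v] by (auto simp: upturn_def L_def)

text \<open>The first maximum of the stretch is entered by an ascent, so its height is positive;
  hence it is not left by an East step, and being a maximum it is left by SE.\<close>

lemma first_max_peak:
  assumes "r \<le> L" "l \<le> p" "p \<le> r" "h l < h p" "h r < h p"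
  obtains i where "l < i" "i < r" "peak P i" "\<And>j. l \<le> j \<Longrightarrow> j \<le> r \<Longrightarrow> h j \<le> h i"
    "\<And>j. l \<le> j \<Longrightarrow> j < i \<Longrightarrow> h j < h i"
proof -
  define M where "M = Max (h ` {l..r})"
  have M: "h j \<le> M" if "l \<le> j" "j \<le> r" for j
    unfolding M_def using that by (intro Max_ge) auto
  define Q where "Q = (\<lambda>i. l \<le> i \<and> i \<le> r \<and> h i = M)"
  define i where "i = (LEAST i. Q i)"
  have "M \<in> h ` {l..r}"
    unfolding M_def using assms by (intro Max_in) auto
  then have "\<exists>i. Q i" by (auto simp: Q_def)
  then have Q: "Q i" unfolding i_def by (rule LeastI_ex)
  have first: "h j < h i" if "l \<le> j" "j < i" for j
    using not_less_Least[of j Q] that Q M[of j] unfolding i_def[symmetric] by (force simp: Q_def)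
  have "h l \<noteq> M" "h r \<noteq> M"
    using M[of p] assms by auto
  with Q have i: "l < i" "i < r"
    by (auto simp: Q_def le_less)
  have 1: "steps P ! (i - 1) \<in> {NE, North}"
    using first[of "i - 1"] ascent_step(1)[of "i - 1"] i assms(1) by auto
  have gt: "h (i - 1) < h i"
    using first i by auto
  have "h (Suc i) \<le> h i"
    using Q M[of "Suc i"] i by (auto simp: Q_def)
  then have "steps P ! i = SE"
    using h_Suc[of i] East_at_0[of i] nonneg[of "i - 1"] gt i assms(1)
    by (cases "steps P ! i") force+
  then have "peak P i"
    using 1 i assms(1) by (auto simp: peak_iff entry_def L_def)
  then show ?thesis
    using that i first M Q by (auto simp: Q_def)
qed

text \<open>The mirror image for the last minimum. It may lie at the left end only when that is
  position 0, where \<open>entry\<close> is SE by convention.\<close>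

lemma last_min_upturn:
  assumes "r \<le> L" "l \<le> p" "p \<le> r" "h p < h r" "l = 0 \<or> h p < h l"
  obtains v where "l \<le> v" "v < r" "upturn (steps P) v" "\<And>j. l \<le> j \<Longrightarrow> j \<le> r \<Longrightarrow> h v \<le> h j"
    "\<And>j. v < j \<Longrightarrow> j \<le> r \<Longrightarrow> h v < h j"
proof -
  define M where "M = Min (h ` {l..r})"
  have M: "M \<le> h j" if "l \<le> j" "j \<le> r" for j
    unfolding M_def using that by (intro Min_le) auto
  define Q where "Q = (\<lambda>i. l \<le> i \<and> i \<le> r \<and> h i = M)"
  define v where "v = (GREATEST i. Q i)"
  have "M \<in> h ` {l..r}"
    unfolding M_def using assms by (intro Min_in) auto
  then have ex: "\<exists>i. Q i" by (auto simp: Q_def)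
  have bd: "Q i \<Longrightarrow> i \<le> r" for i by (simp add: Q_def)
  have Q: "Q v" unfolding v_def using GreatestI_ex_nat[OF ex] bd by blast
  have Q_max: "j \<le> v" if "Q j" for j
    unfolding v_def using that bd by (rule Greatest_le_nat[where P = Q and b = r])
  have last: "h v < h j" if "v < j" "j \<le> r" for j
    using Q_max[of j] that Q M[of j] by (force simp: Q_def)
  have "h r \<noteq> M" "l = 0 \<or> h l \<noteq> M"
    using M[of p] assms by auto
  with Q have v: "l \<le> v" "v < r" "l = 0 \<or> l < v"
    by (auto simp: Q_def le_less)
  have up: "steps P ! v \<in> {NE, North}"
    using last[of "Suc v"] ascent_step(1)[of v] v assms(1) by auto
  have "entry (steps P) v \<in> {SE, East}"
  proof (cases "v = 0")
    case False
    then have "h v \<le> h (v - 1)"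
      using Q M[of "v - 1"] v by (auto simp: Q_def)
    then show ?thesis
      using False h_Suc[of "v - 1"] v assms(1) by (cases "steps P ! (v - 1)") (auto simp: entry_def)
  qed (simp add: entry_def)
  then have "upturn (steps P) v"
    using up v assms(1) by (auto simp: upturn_def L_def)
  then show ?thesis
    using that v last M Q by (auto simp: Q_def)
qed

text \<open>Every step other than East changes both the position and the height by one, up to
  sign.\<close>

lemma parity_without_East:
  assumes "i \<le> j" "j \<le> L" "\<And>t. i \<le> t \<Longrightarrow> t < j \<Longrightarrow> steps P ! t \<noteq> East"
  shows "even (int j - int i - (h j - h i))"
  using assms
proof (induction j rule: dec_induct)
  case (step n)
  then have "even (int n - int i - (h n - h i))" by simp
  moreover have "steps P ! n \<noteq> East" using step by simp
  ultimately show ?case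
    using h_Suc[of n] step by (cases "steps P ! n") auto
qed simp

text \<open>Abscissae are compared through positions along the path: a peak is followed by a SE step,
  so at peaks the two orders agree.\<close>

definition base :: "nat \<Rightarrow> int \<Rightarrow> bool" where
  "base i b \<longleftrightarrow> (\<exists>l r. l \<le> i \<and> i < r \<and> r \<le> L \<and> h l = b \<and> h r = b \<and>
     (\<forall>j. peak P j \<and> l \<le> j \<and> j \<le> r \<longrightarrow> h j \<le> h i \<and> (h j = h i \<longrightarrow> i \<le> j)))"

lemma relative_height_eq:
  assumes i: "peak P i" and b: "base i b" "\<And>b'. base i b' \<Longrightarrow> b \<le> b'"
  shows "relative_height P i = h i - b"
proof -
  have iL: "i < L" using peak_h[OF i] by simp
  have "relative_height P i = (GREATEST d. base i (h i - d))"
    unfolding relative_height_def base_def h_def[symmetric] L_def[symmetric]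
  proof (intro arg_cong[of _ _ Greatest] ext ex_cong1)
    fix d l r
    have "weight P l \<le> weight P i \<longleftrightarrow> l \<le> i" if "l \<le> L" for l
      using peak_weight_le_iff[OF i] that by (simp add: L_def)
    moreover have "weight P i < weight P r \<longleftrightarrow> i < r" if "r \<le> L" for r
      using peak_weight_le_iff[OF i, of r] that by (simp add: L_def not_le[symmetric])
    moreover have "weight P i \<le> weight P j \<longleftrightarrow> i \<le> j" if "peak P j" for j
      using peak_weight_ge_iff[OF that, of i] iL by (simp add: L_def)
    ultimately show "(l \<le> L \<and> r \<le> L \<and> h l = h i - d \<and> h r = h i - d \<and>
         weight P l \<le> weight P i \<and> weight P i < weight P r \<and>
         (\<forall>j. peak P j \<and> l \<le> j \<and> j \<le> r \<longrightarrow>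
              \<not> h i < h j \<and> (h j = h i \<longrightarrow> weight P i \<le> weight P j))) =
        (l \<le> i \<and> i < r \<and> r \<le> L \<and> h l = h i - d \<and> h r = h i - d \<and>
         (\<forall>j. peak P j \<and> l \<le> j \<and> j \<le> r \<longrightarrow> h j \<le> h i \<and> (h j = h i \<longrightarrow> i \<le> j)))"
      using iL by (smt (verit) leD leI le_less_trans less_imp_le_nat)
  qed
  also have "\<dots> = h i - b"
  proof (rule Greatest_equality)
    show "base i (h i - (h i - b))" using b(1) by simp
    fix d assume "base i (h i - d)"
    from b(2)[OF this] show "d \<le> h i - b" by simp
  qed
  finally show ?thesis .
qed

text \<open>The last two conjuncts together say that \<open>i\<close> minus its relative height has
  the parity of \<open>v\<close>.\<close>

definition paired :: "nat \<Rightarrow> nat \<Rightarrow> bool" where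
  "paired v i \<longleftrightarrow> upturn (steps P) v \<and> peak P i \<and> relative_height P i = h i - h v \<and>
     even (int i - int v - (h i - h v))"

text \<open>The upturn lies to the left of its peak. A lower base line would have to start at some
  \<open>l\<close> before \<open>v\<close> and so would enclose the obstacle given by
  \<open>block\<close>; on this side a peak of equal height already is an obstacle.\<close>

lemma paired_left:
  assumes "upturn (steps P) v" "peak P i" "v < i"
    and above: "\<And>j. v < j \<Longrightarrow> j \<le> i \<Longrightarrow> h v < h j"
    and left: "\<And>j. peak P j \<Longrightarrow> v \<le> j \<Longrightarrow> j < i \<Longrightarrow> h j < h i"
    and r: "i < r" "r \<le> L" "h r = h v" "\<And>j. peak P j \<Longrightarrow> i < j \<Longrightarrow> j \<le> r \<Longrightarrow> h j \<le> h i"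
    and block: "\<And>l. l < v \<Longrightarrow> h l < h v \<Longrightarrow> \<exists>j. peak P j \<and> l \<le> j \<and> j < v \<and> h i \<le> h j"
  shows "paired v i"
proof -
  have "h j \<le> h i \<and> (h j = h i \<longrightarrow> i \<le> j)" if "peak P j" "v \<le> j" "j \<le> r" for j
    using left[of j] r(4)[of j] that by (cases j i rule: linorder_cases) auto
  then have "base i (h v)"
    unfolding base_def using assms by (intro exI[of _ v] exI[of _ r]) auto
  moreover have "h v \<le> b" if "base i b" for b
  proof (rule ccontr)
    assume "\<not> h v \<le> b"
    from \<open>base i b\<close> obtain l r where l: "l \<le> i" "h l = b" "i < r"
        "\<And>j. peak P j \<Longrightarrow> l \<le> j \<Longrightarrow> j \<le> r \<Longrightarrow> h j \<le> h i \<and> (h j = h i \<longrightarrow> i \<le> j)"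
      by (auto simp: base_def)
    have "l < v"
      using above[of l] l \<open>\<not> h v \<le> b\<close> by (metis linorder_neqE_nat not_le order_less_imp_le order_refl)
    then obtain j where "peak P j" "l \<le> j" "j < v" "h i \<le> h j"
      using block[of l] l \<open>\<not> h v \<le> b\<close> by auto
    then show False
      using l(3) l(4)[of j] \<open>v < i\<close> by auto
  qed
  ultimately have "relative_height P i = h i - h v"
    by (intro relative_height_eq) (use assms in auto)
  moreover have "steps P ! t \<noteq> East" if "v \<le> t" "t < i" for t
  proof
    assume E: "steps P ! t = East"
    with assms(1) that have "v < t" by (cases "t = v") (auto simp: upturn_def)
    then show False
      using E East_at_0[of t] above[of t] nonneg[of v] that peak_h(1)[OF \<open>peak P i\<close>] by force
  qed
  then have "even (int i - int v - (h i - h v))"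
    using peak_h(1)[OF \<open>peak P i\<close>] \<open>v < i\<close> by (intro parity_without_East) auto
  ultimately show ?thesis
    using assms by (simp add: paired_def)
qed

text \<open>The upturn lies to the right of its peak. On this side an obstacle must be strictly
  higher, and \<open>0 < h v\<close> keeps East steps out of the stretch from \<open>i\<close> to
  \<open>v\<close>.\<close>

lemma paired_right:
  assumes "upturn (steps P) v" "peak P i" "i < v"
    and above: "0 < h v" "\<And>j. i \<le> j \<Longrightarrow> j \<le> v \<Longrightarrow> h v \<le> h j"
    and right: "\<And>j. peak P j \<Longrightarrow> i < j \<Longrightarrow> j \<le> v \<Longrightarrow> h j \<le> h i"
    and l: "l < i" "h l = h v" "\<And>j. peak P j \<Longrightarrow> l \<le> j \<Longrightarrow> j < i \<Longrightarrow> h j < h i"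
    and block: "\<And>r. v < r \<Longrightarrow> r \<le> L \<Longrightarrow> h r < h v \<Longrightarrow> \<exists>j. peak P j \<and> v \<le> j \<and> j \<le> r \<and> h i < h j"
  shows "paired v i"
proof -
  have vL: "v < L" using upturn_h assms by blast
  have "h j \<le> h i \<and> (h j = h i \<longrightarrow> i \<le> j)" if "peak P j" "l \<le> j" "j \<le> v" for j
    using right[of j] l(3)[of j] that by (cases j i rule: linorder_cases) auto
  then have "base i (h v)"
    unfolding base_def using assms vL by (intro exI[of _ l] exI[of _ v]) auto
  moreover have "h v \<le> b" if "base i b" for b
  proof (rule ccontr)
    assume "\<not> h v \<le> b"
    from \<open>base i b\<close> obtain l r where l: "l \<le> i" "h r = b" "i < r" "r \<le> L"
        "\<And>j. peak P j \<Longrightarrow> l \<le> j \<Longrightarrow> j \<le> r \<Longrightarrow> h j \<le> h i"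
      by (auto simp: base_def)
    have "v < r"
      using above(2)[of r] l \<open>\<not> h v \<le> b\<close> by (metis less_imp_le_nat not_le)
    then obtain j where "peak P j" "v \<le> j" "j \<le> r" "h i < h j"
      using block[of r] l \<open>\<not> h v \<le> b\<close> by auto
    then show False
      using l(1) l(5)[of j] \<open>i < v\<close> by auto
  qed
  ultimately have "relative_height P i = h i - h v"
    by (intro relative_height_eq) (use assms in auto)
  moreover have "steps P ! t \<noteq> East" if "i \<le> t" "t < v" for t
    using East_at_0[of t] above(1) above(2)[of t] that vL by force
  then have "even (int v - int i - (h v - h i))"
    using vL \<open>i < v\<close> by (intro parity_without_East) auto
  then have "even (int i - int v - (h i - h v))"
    by presburger
  ultimately show ?thesis
    using assms by (simp add: paired_def)
qed

text \<open>Two mountains meet at \<open>v\<close>: one between \<open>v\<close> and the first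
  return to its level, one between \<open>v\<close> and the last lower point before it. The one with
  the lower summit has its base line at \<open>v\<close>; in a tie it is the right one, because an
  equal peak further left dominates. If no earlier point is lower, the right summit is the
  partner.\<close>

lemma upturn_paired:
  assumes v: "upturn (steps P) v"
  shows "\<exists>i. paired v i"
proof -
  note vL = upturn_h[OF v]
  define R where "R = (\<lambda>r. v < r \<and> r \<le> L \<and> h r \<le> h v)"
  define r where "r = (LEAST r. R r)"
  have "R L"
    using vL ends_at_0 nonneg[of v] by (simp add: R_def)
  then have r: "v < r" "r \<le> L" "h r \<le> h v"
    using LeastI[of R L] unfolding r_def R_def by auto
  have r_above: "h v < h j" if "v < j" "j < r" for j
    using not_less_Least[of j R] that r unfolding r_def[symmetric] by (auto simp: R_def)
  have "Suc v < r"
    using r vL by (metis Suc_lessI less_add_one not_le)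
  then obtain r' where r': "r = Suc r'" "v < r'"
    by (cases r) auto
  then have hr: "h r = h v"
    using h_step[of r'] r_above[of r'] r by auto
  have c: "r \<le> L" "v \<le> Suc v" "Suc v \<le> r" "h v < h (Suc v)" "h r < h (Suc v)"
    using r vL \<open>Suc v < r\<close> by auto
  obtain i where i: "v < i" "i < r" "peak P i" "\<And>j. v \<le> j \<Longrightarrow> j \<le> r \<Longrightarrow> h j \<le> h i"
      "\<And>j. v \<le> j \<Longrightarrow> j < i \<Longrightarrow> h j < h i"
    using first_max_peak[OF c] by blast
  show ?thesis
  proof (cases "\<exists>l<v. h l < h v")
    case False
    then have "paired v i"
      using i r hr r_above v by (intro paired_left[of v i r]) auto
    then show ?thesis ..
  next
    case True
    define K where "K = (\<lambda>l. l < v \<and> h l < h v)"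
    define l where "l = (GREATEST l. K l)"
    have bd: "K j \<Longrightarrow> j \<le> v" for j by (simp add: K_def)
    have "\<exists>l. K l" using True by (auto simp: K_def)
    then have "K l" unfolding l_def using GreatestI_ex_nat bd by blast
    then have l: "l < v" "h l < h v" by (auto simp: K_def)
    have l_max: "l' \<le> l" if "l' < v" "h l' < h v" for l'
      unfolding l_def using that by (intro Greatest_le_nat[of K _ v]) (auto simp: K_def)
    have l_above: "h v \<le> h j" if "l < j" "j \<le> v" for j
      using l_max[of j] that by (cases "j = v") force+
    have "h v < h (v - 1)"
      using v l nonneg[of l] h_Suc[of "v - 1"] East_at_0[of "v - 1"] vL
      by (auto simp: upturn_def entry_def split: if_splits)
    then have c: "v \<le> L" "l \<le> v - 1" "v - 1 \<le> v" "h l < h (v - 1)" "h v < h (v - 1)"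
      using l vL by auto
    obtain i' where i': "l < i'" "i' < v" "peak P i'" "\<And>j. l \<le> j \<Longrightarrow> j \<le> v \<Longrightarrow> h j \<le> h i'"
      "\<And>j. l \<le> j \<Longrightarrow> j < i' \<Longrightarrow> h j < h i'"
      using first_max_peak[OF c] by blast
    show ?thesis
    proof (cases "h i \<le> h i'")
      case True
      have "paired v i"
      proof (rule paired_left[of v i r])
        fix l' assume "l' < v" "h l' < h v"
        then show "\<exists>j. peak P j \<and> l' \<le> j \<and> j < v \<and> h i \<le> h j"
          using l_max[of l'] i' True by (intro exI[of _ i']) auto
      qed (use i r hr r_above v in auto)
      then show ?thesis ..
    next
      case False
      obtain l0 where l0: "l \<le> l0" "l0 \<le> i'" "h l0 = h v"
        using crosses_up[of l i' "h v"] i' l vL l_above[of i'] by auto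
      have "h v < h i'" using i'(4)[OF c(2,3)] c(5) by simp
      then have "l0 < i'" using l0 by (cases "l0 = i'") auto
      have "paired v i'"
      proof (rule paired_right[of v i' l0])
        show "0 < h v" using l nonneg[of l] vL by auto
        fix r' assume "v < r'" "r' \<le> L" "h r' < h v"
        then have "r \<le> r'"
          using r_above[of r'] by force
        then show "\<exists>j. peak P j \<and> v \<le> j \<and> j \<le> r' \<and> h i' < h j"
          using i False by (intro exI[of _ i]) auto
      qed (use i' l0 \<open>l0 < i'\<close> v l_above in auto)
      then show ?thesis ..
    qed
  qed
qed

text \<open>The relative height is the topographic prominence: going down from \<open>i\<close>
  towards the nearest dominating ground on either side (at least as high on the left, strictly
  higher on the right), the base line is the higher of the two lowest saddles, \<open>v\<close> and
  \<open>u\<close>.\<close>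

lemma peak_paired:
  assumes i: "peak P i"
  shows "\<exists>v. paired v i"
proof -
  note iL = peak_h[OF i]
  define K where "K = (\<lambda>p. p < i \<and> h i \<le> h p)"
  \<comment> \<open>With nothing dominating on the left, \<open>p\<close> is 0, the one left end at
    which \<open>last_min_upturn\<close> allows the minimum.\<close>
  define p where "p = (if \<exists>p. K p then GREATEST p. K p else 0)"
  have bd: "K j \<Longrightarrow> j \<le> i" for j by (simp add: K_def)
  have p: "K p" if "\<exists>p. K p"
    unfolding p_def using that GreatestI_ex_nat[of K] bd by auto
  have p_max: "j \<le> p" if "K j" for j
  proof -
    have ex: "\<exists>p. K p" using that by blast
    show ?thesis
      unfolding p_def if_P[OF ex] using that bd by (rule Greatest_le_nat[where P = K and b = i])
  qed
  have p_above: "h j < h i" if "p < j" "j < i" for j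
    using p_max[of j] that by (force simp: K_def)
  have p_lt: "p < i" using p iL by (cases "\<exists>p. K p") (auto simp: K_def p_def)
  have edge: "p = 0 \<or> h (i - 1) < h p"
    using p iL by (cases "\<exists>p. K p") (auto simp: K_def p_def)
  have c: "i \<le> L" "p \<le> i - 1" "i - 1 \<le> i" "h (i - 1) < h i"
    using p_lt iL by auto
  obtain v where v: "p \<le> v" "v < i" "upturn (steps P) v" "\<And>j. p \<le> j \<Longrightarrow> j \<le> i \<Longrightarrow> h v \<le> h j"
      "\<And>j. v < j \<Longrightarrow> j \<le> i \<Longrightarrow> h v < h j"
    using last_min_upturn[OF c edge] by blast
  have "h v < h i" using v by auto
  have vleft: "h j < h i" if "v \<le> j" "j < i" for j
  proof (cases "j = p")
    case True
    then show ?thesis using v(1) that \<open>h v < h i\<close> by simp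
  qed (use that v p_above in auto)
  \<comment> \<open>The left saddle is the partner as soon as its level is met again on the right
    before a higher peak. This covers both the case without dominating ground on the right and the
    case of a right saddle that is not higher.\<close>
  have left: ?thesis if r: "i < r" "r \<le> L" "h r = h v" "\<And>j. peak P j \<Longrightarrow> i < j \<Longrightarrow> j \<le> r \<Longrightarrow> h j \<le> h i" for r
  proof -
    have "paired v i"
    proof (rule paired_left[of v i r])
      fix l assume l: "l < v" "h l < h v"
      then have "l < p" using v(4)[of l] v(2) by force
      then have "\<exists>p. K p" by (auto simp: p_def split: if_splits)
      then have hp: "h i \<le> h p" "K p"
        using p by (auto simp: K_def)
      have "p < v" using hp \<open>h v < h i\<close> v(1) by (cases "p = v") auto
      have c: "v \<le> L" "l \<le> p" "p \<le> v" "h l < h p" "h v < h p"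
        using l \<open>l < p\<close> \<open>p < v\<close> hp \<open>h v < h i\<close> v(2) iL by auto
      obtain j where "l < j" "j < v" "peak P j" "\<And>t. l \<le> t \<Longrightarrow> t \<le> v \<Longrightarrow> h t \<le> h j"
          "\<And>t. l \<le> t \<Longrightarrow> t < j \<Longrightarrow> h t < h j"
        using first_max_peak[OF c] by blast
      then show "\<exists>j. peak P j \<and> l \<le> j \<and> j < v \<and> h i \<le> h j"
        using hp \<open>l < p\<close> \<open>p < v\<close> by (intro exI[of _ j]) (meson less_imp_le_nat order_trans)
    qed (use v i r vleft in auto)
    then show ?thesis ..
  qed
  define R where "R = (\<lambda>q. i < q \<and> q \<le> L \<and> h i < h q)"
  show ?thesis
  proof (cases "\<exists>q. R q")
    case False
    have below: "h j \<le> h i" if "i < j" "j \<le> L" for j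
      using False that by (force simp: R_def)
    obtain r where r: "i \<le> r" "r \<le> L" "h r = h v"
      using crosses_down[of i L "h v"] iL \<open>h v < h i\<close> ends_at_0 nonneg[of v] v by auto
    moreover have "i \<noteq> r" using r \<open>h v < h i\<close> by auto
    ultimately show ?thesis
      using below by (intro left[of r]) auto
  next
    case True
    define q where "q = (LEAST q. R q)"
    have "R q" unfolding q_def using True by (rule LeastI_ex)
    then have q: "i < q" "q \<le> L" "h i < h q" by (auto simp: R_def)
    have q_below: "h j \<le> h i" if "i < j" "j < q" for j
      using not_less_Least[of j R] that q unfolding q_def[symmetric] by (auto simp: R_def)
    have c: "q \<le> L" "i \<le> Suc i" "Suc i \<le> q" "h (Suc i) < h q" "i = 0 \<or> h (Suc i) < h i"
      using q iL by auto
    obtain u where u: "i \<le> u" "u < q" "upturn (steps P) u" "\<And>j. i \<le> j \<Longrightarrow> j \<le> q \<Longrightarrow> h u \<le> h j"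
      "\<And>j. u < j \<Longrightarrow> j \<le> q \<Longrightarrow> h u < h j"
      using last_min_upturn[OF c] by blast
    have "h u < h i" using u(4)[of "Suc i"] q iL by auto
    then have "i < u" using u by (cases "i = u") auto
    show ?thesis
    proof (cases "h u \<le> h v")
      case True
      obtain r where r: "i \<le> r" "r \<le> u" "h r = h v"
        using crosses_down[of i u "h v"] u True \<open>h v < h i\<close> q by auto
      moreover have "i \<noteq> r" using r \<open>h v < h i\<close> by auto
      ultimately show ?thesis
        using u q q_below by (intro left[of r]) force+
    next
      case False
      obtain l where l: "v \<le> l" "l \<le> i" "h l = h u"
        using crosses_up[of v i "h u"] v False \<open>h u < h i\<close> iL by auto
      moreover have "l \<noteq> i" using l \<open>h u < h i\<close> by auto
      ultimately have "l < i" by simp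
      have "paired u i"
      proof (rule paired_right[of u i l])
        show "0 < h u" using False nonneg[of v] v iL by auto
        fix r assume r: "u < r" "r \<le> L" "h r < h u"
        then have "q < r" using u(5)[of r] by force
        then have c: "r \<le> L" "u \<le> q" "q \<le> r" "h u < h q" "h r < h q"
          using r u(2) q \<open>h u < h i\<close> by auto
        obtain j where "u < j" "j < r" "peak P j" "\<And>t. u \<le> t \<Longrightarrow> t \<le> r \<Longrightarrow> h t \<le> h j"
            "\<And>t. u \<le> t \<Longrightarrow> t < j \<Longrightarrow> h t < h j"
          using first_max_peak[OF c] by blast
        then show "\<exists>j. peak P j \<and> u \<le> j \<and> j \<le> r \<and> h i < h j"
          using q u(2) \<open>q < r\<close> by (intro exI[of _ j]) (meson less_imp_le_nat order_less_le_trans)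
      qed (use u i \<open>i < u\<close> \<open>l < i\<close> l vleft q_below in \<open>auto simp: less_imp_le\<close>)
      then show ?thesis ..
    qed
  qed
qed

end

section \<open>Parity of peaks and parity of positions\<close>

lemma lattice_path_mountain:
  assumes "lattice_path P" shows "mountain_path P"
  using assms by unfold_locales (auto simp: lattice_path_def)

lemma North_SE:
  assumes "lattice_path P" "i < length (steps P)" "steps P ! i = North"
  shows "Suc i < length (steps P)" "steps P ! Suc i = SE"
  using assms by (auto simp: lattice_path_def)

text \<open>Each NSE peak ends a North step, so W(x) counts the North steps before position
  \<open>i\<close> and x + W(x) = \<open>i\<close>; replacing - W(x) by + W(x) does not affect
  parity.\<close>

lemma even_peak_iff:
  assumes P: "lattice_path P" and i: "peak P i"
  shows "even_peak P i \<longleftrightarrow> odd (int i - relative_height P i)"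
proof -
  have "{j. NSE_peak P j \<and> weight P j \<le> weight P i} = Suc ` {t. t < i \<and> steps P ! t = North}"
  proof (intro set_eqI iffI)
    fix j assume "j \<in> {j. NSE_peak P j \<and> weight P j \<le> weight P i}"
    then have j: "0 < j" "j < length (steps P)" "steps P ! (j - 1) = North" "j \<le> i"
      using peak_weight_le_iff[OF i, of j] by (auto simp: NSE_peak_def)
    then show "j \<in> Suc ` {t. t < i \<and> steps P ! t = North}"
      by (intro image_eqI[of _ _ "j - 1"]) auto
  next
    fix j assume "j \<in> Suc ` {t. t < i \<and> steps P ! t = North}"
    then show "j \<in> {j. NSE_peak P j \<and> weight P j \<le> weight P i}"
      using North_SE[OF P] peak_weight_le_iff[OF i, of j] i by (auto simp: NSE_peak_def peak_iff)
  qed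
  then have "NSE_count P (weight P i) = card {t. t < i \<and> steps P ! t = North}"
    unfolding NSE_count_def by (simp add: card_image)
  then have "weight P i + int (NSE_count P (weight P i)) = int i"
    using index_eq_weight_plus_North[of i P] i by (simp add: peak_iff)
  then show ?thesis
    unfolding even_peak_def by presburger
qed

lemma all_even_iff_upturns_odd:
  assumes P: "lattice_path P"
  shows "(\<forall>i. peak P i \<longrightarrow> even_peak P i) \<longleftrightarrow> (\<forall>v. upturn (steps P) v \<longrightarrow> odd v)"
proof -
  interpret mountain_path P "length (steps P)" "height P"
    using lattice_path_mountain[OF P] by simp
  have "even_peak P i \<longleftrightarrow> odd v" if "paired v i" for v i
  proof -
    from that have p: "peak P i" "relative_height P i = height P i - height P v"
        "even (int i - int v - (height P i - height P v))"
      by (auto simp: paired_def)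
    have "odd (int i - relative_height P i) \<longleftrightarrow> odd (int v)"
      using p(3) unfolding p(2) by presburger
    then show ?thesis
      using even_peak_iff[OF P p(1)] by simp
  qed
  then show ?thesis
    using upturn_paired peak_paired paired_def by metis
qed

section \<open>Words with odd upturns\<close>

text \<open>The last step (SE at the start of a path), whether the number of steps taken is odd, and the
  height.\<close>

type_synonym state = "step \<times> bool \<times> int"

text \<open>A climb may continue from NE at any position, but may begin only at an odd one. As
  position 0 is even and counts as entered by SE, this also enforces the rule on the leftmost peak:
  the first step is SE, or East on the ground.\<close>

definition allowed :: "nat \<Rightarrow> state \<Rightarrow> step \<Rightarrow> bool" where
  "allowed k st s = (case st of (e, p, h) \<Rightarrow>
     (case s of
        SE \<Rightarrow> 1 \<le> h
      | East \<Rightarrow> e \<noteq> North \<and> h = 0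
      | _ \<Rightarrow> e \<noteq> North \<and> (e = NE \<or> p) \<and> h + 1 < int k))"

definition move :: "state \<Rightarrow> step \<Rightarrow> state" where
  "move st s = (case st of (e, p, h) \<Rightarrow>
     (s, \<not> p, h + (case s of NE \<Rightarrow> 1 | SE \<Rightarrow> -1 | North \<Rightarrow> 1 | East \<Rightarrow> 0)))"

fun admissible :: "nat \<Rightarrow> state \<Rightarrow> step list \<Rightarrow> bool" where
  "admissible k (e, p, h) [] \<longleftrightarrow> e = SE \<and> h = 0"
| "admissible k st (s # w) \<longleftrightarrow> allowed k st s \<and> admissible k (move st s) w"

definition peak_step :: "state \<Rightarrow> step \<Rightarrow> nat" where
  "peak_step st s = (if s = SE \<and> fst st \<in> {NE, North} then 1 else 0)"

fun peaks :: "state \<Rightarrow> step list \<Rightarrow> nat" where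
  "peaks st [] = 0"
| "peaks st (s # w) = peak_step st s + peaks (move st s) w"

text \<open>The major index with abscissae measured from the current vertex.\<close>

fun major :: "state \<Rightarrow> step list \<Rightarrow> nat" where
  "major st [] = 0"
| "major st (s # w) = major (move st s) w + (if s = North then 0 else peaks (move st s) w)"

section \<open>Agreement of the automaton with the lattice paths\<close>

lemma admissible_iff:
  "admissible k st w \<longleftrightarrow>
     (\<forall>i < length w. allowed k (foldl move st (take i w)) (w ! i)) \<and>
     admissible k (foldl move st w) []"
  by (induction k st w rule: admissible.induct) (auto simp: All_less_Suc2)

lemma peaks_eq:
  "peaks st w = (\<Sum>i<length w. peak_step (foldl move st (take i w)) (w ! i))"
  by (induction st w rule: peaks.induct) (simp_all add: sum.lessThan_Suc_shift del: sum.lessThan_Suc)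

lemma major_eq:
  "major st w = (\<Sum>i<length w. peak_step (foldl move st (take i w)) (w ! i) *
     length (filter (\<lambda>s. s \<noteq> North) (take i w)))"
  by (induction st w rule: major.induct)
    (simp_all add: sum.lessThan_Suc_shift peaks_eq algebra_simps sum.distrib del: sum.lessThan_Suc)

lemma state_at:
  "i \<le> length w \<Longrightarrow>
   foldl move (SE, False, h) (take i w) = (entry w i, odd i, height (h, w) i)"
proof (induction i)
  case 0
  then show ?case by (simp add: entry_def height_0 start_height_def)
next
  case (Suc i)
  then show ?case
    by (simp add: take_Suc_conv_app_nth move_def entry_def height_Suc steps_def)
qed

lemma weight_eq_length_filter:
  "i \<le> length w \<Longrightarrow> weight (h, w) i = int (length (filter (\<lambda>s. s \<noteq> North) (take i w)))"
  by (induction i) (auto simp: take_Suc_conv_app_nth weight_Suc steps_def)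

lemma major_index_eq: "major_index (h, w) = int (major (SE, False, h) w)"
proof -
  have "major_index (h, w) = (\<Sum>i | i < length w \<and> peak (h, w) i. weight (h, w) i)"
    unfolding major_index_def by (rule arg_cong2[of _ _ _ _ sum]) (auto simp: peak_iff steps_def)
  also have "\<dots> = (\<Sum>i<length w. if peak (h, w) i then weight (h, w) i else 0)"
    by (subst sum.inter_filter[symmetric]) (auto intro: sum.cong)
  also have "\<dots> = int (major (SE, False, h) w)"
    unfolding major_eq of_nat_sum
    by (intro sum.cong) (auto simp: state_at weight_eq_length_filter peak_step_def peak_iff steps_def)
  finally show ?thesis .
qed

lemma admissible_words:
  "admissible k (SE, False, int k - int a) w \<longleftrightarrow>
     lattice_path (int k - int a, w) \<and> special_conditions k a (int k - int a, w) \<and>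
     (\<forall>i. peak (int k - int a, w) i \<longrightarrow> even_peak (int k - int a, w) i)"
  if "1 \<le> a" "a \<le> k"
proof -
  define P where "P = (int k - int a, w)"
  have P: "steps P = w" "start_height P = int k - int a"
    by (simp_all add: P_def steps_def start_height_def)
  have adm: "admissible k (SE, False, int k - int a) w \<longleftrightarrow>
      (\<forall>i < length w. allowed k (entry w i, odd i, height P i) (w ! i)) \<and>
      entry w (length w) = SE \<and> height P (length w) = 0"
    unfolding admissible_iff[of k _ w] using state_at[of "length w" w "int k - int a"]
    by (simp add: state_at P_def)
  have h_Suc: "height P (Suc i) = height P i +
      (case w ! i of NE \<Rightarrow> 1 | SE \<Rightarrow> -1 | North \<Rightarrow> 1 | East \<Rightarrow> 0)" if "i < length w" for i
    using height_Suc[of i P] that by (simp add: P)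
  show ?thesis
    unfolding P_def[symmetric] adm
  proof (intro iffI conjI allI impI; elim conjE)
    assume al: "\<forall>i<length w. allowed k (entry w i, odd i, height P i) (w ! i)"
      and last: "entry w (length w) = SE" "height P (length w) = 0"
    have range: "0 \<le> height P i \<and> height P i < int k" if "i \<le> length w" for i
      using that
    proof (induction i)
      case 0
      then show ?case using \<open>1 \<le> a\<close> \<open>a \<le> k\<close> by (simp add: P)
    next
      case (Suc i)
      then show ?case
        using h_Suc[of i] al by (auto simp: allowed_def split: step.splits dest!: spec[of _ i])
    qed
    have N: "Suc i < length w \<and> w ! Suc i = SE" if "i < length w" "w ! i = North" for i
    proof -
      have "Suc i < length w"
      proof (rule ccontr)
        assume "\<not> Suc i < length w"
        with that have "length w = Suc i" by simp
        with last(1) that show False by (simp add: entry_def)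
      qed
      then show ?thesis
        using al that by (cases "w ! Suc i") (auto simp: allowed_def entry_def dest!: spec[of _ "Suc i"])
    qed
    have start: "w ! 0 = SE \<or> (start_height P = 0 \<and> w ! 0 = East)" if "w \<noteq> []"
      using al that by (cases "w ! 0") (auto simp: allowed_def entry_def P dest!: spec[of _ 0])
    show lp: "lattice_path P"
      unfolding lattice_path_def P
    proof (intro conjI allI impI)
      show "height P i = 0" if "i < length w" "w ! i = East" for i
        using al that by (auto simp: allowed_def dest!: spec[of _ i])
      show "w = [] \<or> last w = SE"
        using last(1) by (cases "w = []") (auto simp: entry_def last_conv_nth)
      show "w ! 0 = SE \<or> (int k - int a = 0 \<and> w ! 0 = East)"
        if "NSE_peak P i \<and> (\<forall>j<i. \<not> peak P j)" for i
        using start that by (cases "w = []") (auto simp: NSE_peak_def P)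
    qed (use range last N in auto)
    show "special_conditions k a P"
      unfolding special_conditions_def P using range by auto
    show "even_peak P i" if "peak P i" for i
    proof -
      have "odd v" if "upturn w v" for v
        using al that by (auto simp: upturn_def allowed_def dest!: spec[of _ v])
      then show ?thesis
        using all_even_iff_upturns_odd[OF lp] that by (simp add: P)
    qed
  next
    fix i
    assume lp: "lattice_path P" and sp: "special_conditions k a P"
      and ev: "\<forall>i. peak P i \<longrightarrow> even_peak P i" and i: "i < length w"
    have up: "odd v" if "upturn w v" for v
      using all_even_iff_upturns_odd[OF lp] that ev by (simp add: P)
    have h: "0 \<le> height P (Suc i)" "height P (Suc i) < int k"
      using lp sp i by (auto simp: lattice_path_def special_conditions_def P)
    have N: "entry w i = North \<Longrightarrow> w ! i = SE"
      using North_SE(2)[OF lp, of "i - 1"] i by (auto simp: entry_def P split: if_splits)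
    show "allowed k (entry w i, odd i, height P i) (w ! i)"
    proof (cases "w ! i")
      case East
      then show ?thesis
        using N lp i by (auto simp: allowed_def lattice_path_def P)
    qed (use N h h_Suc[OF i] up[of i] i in \<open>cases "entry w i"; auto simp: allowed_def upturn_def\<close>)+
  next
    assume lp: "lattice_path P"
    show "entry w (length w) = SE"
      using lp by (auto simp: lattice_path_def P entry_def last_conv_nth)
    show "height P (length w) = 0"
      using lp by (auto simp: lattice_path_def P)
  qed
qed

section \<open>Counting words by peaks and major index\<close>

lemma UNIV_step: "(UNIV :: step set) = {NE, SE, North, East}"
  using step.exhaust by auto

definition words :: "nat \<Rightarrow> state \<Rightarrow> nat \<Rightarrow> nat \<Rightarrow> step list set" where
  "words k st n m = {w. admissible k st w \<and> peaks st w = n \<and> major st w = m}"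

definition gf :: "nat \<Rightarrow> state \<Rightarrow> nat \<Rightarrow> rat fps" where
  "gf k st n = Abs_fps (\<lambda>m. of_nat (card (words k st n m)))"

text \<open>East steps are confined to height 0, so the other states entered by an East step are
  unreachable; for them the facts below would fail.\<close>

definition reachable :: "state \<Rightarrow> bool" where
  "reachable st \<longleftrightarrow> (case st of (e, p, h) \<Rightarrow> e = East \<longrightarrow> h = 0)"

lemma reachable_move: "reachable st \<Longrightarrow> allowed k st s \<Longrightarrow> reachable (move st s)"
  by (cases s) (auto simp: reachable_def allowed_def move_def)

text \<open>A climb has to come down again, and after an East step, at height 0, a climb must come
  before the final SE.\<close>

lemma peaks_pos:
  "admissible k st w \<Longrightarrow> reachable st \<Longrightarrow> fst st \<noteq> SE \<Longrightarrow> 0 < peaks st w"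
proof (induction k st w rule: admissible.induct)
  case (2 k st s w)
  obtain e p h where st: "st = (e, p, h)" by (cases st)
  show ?case
  proof (cases "s = SE")
    case True
    then show ?thesis
      using 2 st by (cases e) (auto simp: allowed_def reachable_def peak_step_def)
  next
    case False
    then show ?thesis
      using 2 reachable_move[of st k s] by (auto simp: move_def split: prod.splits)
  qed
qed simp

text \<open>A potential argument for finiteness: a SE step is paid by the height, a NE or East step
  by the major index, since it moves a later peak to the right. A North step has no width and is
  paid by its peak; the 2 subtracted after it is the advance on that peak.\<close>

lemma length_bound:
  "admissible k st w \<Longrightarrow> reachable st \<Longrightarrow>
   int (length w) \<le> 2 * int (major st w) + snd (snd st) + 2 * int (peaks st w)
     - (if fst st = North then 2 else 0)"
proof (induction k st w rule: admissible.induct)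
  case (2 k st s w)
  obtain e p h where st: "st = (e, p, h)" by (cases st)
  have r: "reachable (move st s)" 
    by (rule reachable_move[of st k s]) (use 2 in auto)
  then have pos: "s \<noteq> SE \<Longrightarrow> 0 < peaks (move st s) w"
    using peaks_pos[of k "move st s" w] 2 by (auto simp: st move_def)
  have IH: "int (length w) \<le> 2 * int (major (move st s) w) + snd (snd (move st s))
      + 2 * int (peaks (move st s) w) - (if fst (move st s) = North then 2 else 0)"
    using 2 r by auto
  have al: "allowed k st s" using 2 by simp
  show ?case
  proof (cases s)
    case NE
    with IH pos al show ?thesis by (auto simp: st allowed_def move_def peak_step_def)
  next
    case SE
    with IH al show ?thesis by (auto simp: st allowed_def move_def peak_step_def)
  next
    case North
    with IH pos al show ?thesis by (auto simp: st allowed_def move_def peak_step_def)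
  next
    case East
    with IH pos al show ?thesis by (auto simp: st allowed_def move_def peak_step_def)
  qed
qed simp

lemma finite_words:
  assumes "reachable st" shows "finite (words k st n m)"
proof (rule finite_subset)
  show "words k st n m \<subseteq> {w. set w \<subseteq> UNIV \<and> length w \<le> nat (2 * int m + snd (snd st) + 2 * int n)}"
    using length_bound[OF _ assms] by (fastforce simp: words_def split: if_splits)
  show "finite \<dots>"
    by (intro finite_lists_length_le) (simp add: UNIV_step)
qed

definition shift :: "step \<Rightarrow> nat \<Rightarrow> nat" where
  "shift s n = (if s = North then 0 else n)"

text \<open>A step of width one moves all later peaks by one and so multiplies by q to their number.
  This is why the series are kept apart by the number of peaks.\<close>

lemma gf_unfold:
  assumes st: "reachable st"
  shows "gf k st n = (if admissible k st [] \<and> n = 0 then 1 else 0) +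
    (\<Sum>s\<in>{NE, SE, North, East}. if allowed k st s \<and> peak_step st s \<le> n
       then fps_X ^ shift s (n - peak_step st s) * gf k (move st s) (n - peak_step st s) else 0)"
proof (rule fps_ext)
  fix m :: nat
  define eps where "eps = (if admissible k st [] \<and> n = 0 \<and> m = 0 then {[] :: step list} else {})"
  define T where "T s = {w. s # w \<in> words k st n m}" for s
  have split: "words k st n m = eps \<union> (\<Union>s\<in>UNIV. (#) s ` T s)" (is "?W = _")
  proof (intro set_eqI)
    fix w show "w \<in> ?W \<longleftrightarrow> w \<in> eps \<union> (\<Union>s\<in>UNIV. (#) s ` T s)"
      by (cases w) (auto simp: words_def eps_def T_def)
  qed
  have T: "T s = (if allowed k st s \<and> peak_step st s \<le> n \<and> shift s (n - peak_step st s) \<le> m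
      then words k (move st s) (n - peak_step st s) (m - shift s (n - peak_step st s)) else {})" for s
    by (auto simp: T_def words_def shift_def)
  have fin: "finite (T s)" for s
    unfolding T using reachable_move[OF st] by (auto intro: finite_words)
  have "card ?W = card eps + card (\<Union>s\<in>UNIV. (#) s ` T s)"
    unfolding split using fin by (intro card_Un_disjoint) (auto simp: eps_def UNIV_step)
  also have "card (\<Union>s\<in>UNIV. (#) s ` T s) = (\<Sum>s\<in>UNIV. card ((#) s ` T s))"
    using fin by (intro card_UN_disjoint) (auto simp: UNIV_step)
  also have "\<dots> = (\<Sum>s\<in>UNIV. card (T s))"
    by (intro sum.cong) (auto intro!: card_image simp: inj_on_def)
  finally have "of_nat (card ?W) = of_nat (card eps) + (\<Sum>s\<in>UNIV. of_nat (card (T s)) :: rat)"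
    by simp
  moreover have "of_nat (card (T s)) = fps_nth (if allowed k st s \<and> peak_step st s \<le> n
       then fps_X ^ shift s (n - peak_step st s) * gf k (move st s) (n - peak_step st s) else 0) m" for s
    by (simp add: T gf_def fps_X_power_mult_nth)
  moreover have "of_nat (card eps) = fps_nth (if admissible k st [] \<and> n = 0 then 1 else 0 :: rat fps) m"
    by (simp add: eps_def)
  ultimately show "fps_nth (gf k st n) m = fps_nth ((if admissible k st [] \<and> n = 0 then 1 else 0) +
    (\<Sum>s\<in>{NE, SE, North, East}. if allowed k st s \<and> peak_step st s \<le> n
       then fps_X ^ shift s (n - peak_step st s) * gf k (move st s) (n - peak_step st s) else 0)) m"
    unfolding fps_add_nth fps_sum_nth UNIV_step by (simp only: gf_def fps_nth_Abs_fps)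
qed

section \<open>Elimination of all states except SE at an odd position\<close>

lemma gf_no_peaks:
  assumes "reachable st" "fst st \<noteq> SE" shows "gf k st 0 = 0"
proof -
  have "words k st 0 m = {}" for m
    using peaks_pos[OF _ assms] by (force simp: words_def)
  then show ?thesis by (simp add: gf_def fps_eq_iff)
qed

lemma gf_NE:
  "1 \<le> h \<Longrightarrow> gf k (NE, p, h) (Suc n) =
    (if h + 1 < int k then fps_X ^ Suc n * gf k (NE, \<not> p, h + 1) (Suc n)
       + fps_X ^ n * gf k (SE, p, h) n else 0)
    + fps_X ^ n * gf k (SE, \<not> p, h - 1) n"
  by (simp add: gf_unfold[of "(NE, _, _)"] gf_unfold[of "(North, _, _)"] reachable_def
      allowed_def move_def peak_step_def shift_def del: power_Suc)

text \<open>On the ground at an odd position the same steps are possible after SE and after East;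
  only after SE may the word end.\<close>

lemma gf_SE_True_0:
  "gf k (SE, True, 0) n = (if n = 0 then 1 else 0) + gf k (East, True, 0) n"
  by (simp add: gf_unfold[of "(SE, True, 0)"] gf_unfold[of "(East, True, 0)"] reachable_def
      allowed_def move_def peak_step_def shift_def)

lemma gf_SE_0: "gf k (SE, p, int h) 0 = 1"
proof (induction h arbitrary: p)
  case 0
  then show ?case
    by (subst gf_unfold) (simp_all add: reachable_def allowed_def move_def peak_step_def shift_def gf_no_peaks)
next
  case (Suc h)
  then show ?case
    by (subst gf_unfold) (simp_all add: reachable_def allowed_def move_def peak_step_def shift_def gf_no_peaks)
qed

abbreviation gf_odd :: "nat \<Rightarrow> nat \<Rightarrow> nat \<Rightarrow> rat fps" where
  "gf_odd k h n \<equiv> gf k (SE, True, int h) n"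

text \<open>At an even position no climb may begin, so the next step is SE, or East on the ground,
  where the truncated subtraction keeps the height at 0.\<close>

lemma gf_SE_False: "gf k (SE, False, int h) n = fps_X ^ n * gf_odd k (h - 1) n"
proof (cases "h = 0")
  case True
  then show ?thesis
    by (subst gf_unfold, simp add: reachable_def)
      (simp add: allowed_def move_def peak_step_def shift_def gf_SE_True_0 gf_no_peaks reachable_def)
next
  case False
  then show ?thesis
    by (subst gf_unfold, simp add: reachable_def)
      (simp add: allowed_def move_def peak_step_def shift_def of_nat_diff)
qed

lemma gf_East_False: "gf k (East, False, 0) (Suc n) = fps_X ^ Suc n * gf_odd k 0 (Suc n)"
  by (subst gf_unfold, simp add: reachable_def)
    (simp add: allowed_def move_def peak_step_def shift_def gf_SE_True_0 del: power_Suc)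

text \<open>A descent is followed by a second forced step, hence \<open>h - 2\<close> and two
  factors of q^(n+1). North with its SE returns to the same height at an odd position, with one peak
  used up.\<close>

lemma gf_odd_Suc:
  "gf_odd k h (Suc n) = fps_X ^ (2 * Suc n) * gf_odd k (h - 2) (Suc n) +
    (if h + 1 < k then fps_X ^ Suc n * gf k (NE, False, int h + 1) (Suc n)
       + fps_X ^ n * gf_odd k h n else 0)"
proof -
  have *: "fps_X ^ (2 * Suc n) * f = fps_X ^ Suc n * (fps_X ^ Suc n * f)" for f :: "rat fps"
    by (simp only: mult_2 power_add mult.assoc)
  have "gf k (North, False, int h + 1) (Suc n) = fps_X ^ n * gf_odd k h n"
    by (subst gf_unfold, simp add: reachable_def)
      (simp add: allowed_def move_def peak_step_def shift_def)
  moreover have "gf k (SE, False, int h - 1) (Suc n) = fps_X ^ Suc n * gf_odd k (h - 2) (Suc n)"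
    if "1 \<le> h"
    using gf_SE_False[of k "h - 1" "Suc n"] that by (simp add: of_nat_diff numeral_2_eq_2)
  ultimately show ?thesis
    unfolding *
    by (subst gf_unfold, simp add: reachable_def)
      (auto simp add: allowed_def move_def peak_step_def shift_def gf_East_False Suc_le_eq
        simp del: power_Suc)
qed

lemma gf_odd_edge: "gf_odd (Suc J) J (Suc n) = fps_X ^ (2 * Suc n) * gf_odd (Suc J) (J - 2) (Suc n)"
  by (subst gf_odd_Suc) simp

lemma gf_NE_False:
  "gf k (NE, False, int h + 1) (Suc n) =
    (if h + 2 < k then fps_X ^ Suc n * gf k (NE, True, int h + 2) (Suc n)
       + fps_X ^ n * (fps_X ^ n * gf_odd k h n) else 0)
    + fps_X ^ n * gf_odd k h n"
proof -
  have "gf k (SE, False, int h + 1) n = fps_X ^ n * gf_odd k h n"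
    using gf_SE_False[of k "Suc h" n] by (simp add: add.commute)
  then show ?thesis
    by (subst gf_NE) (auto simp: add.commute)
qed

text \<open>At an odd position the steps that continue a climb are those that begin one. So this
  series and \<open>gf_odd\<close> at the same height share their ascending terms, and subtracting
  removes the NE states from the recurrences.\<close>

lemma gf_NE_True:
  "gf k (NE, True, int h + 2) (Suc n) = gf_odd k (h + 2) (Suc n)
    - fps_X ^ (2 * Suc n) * gf_odd k h (Suc n) + fps_X ^ n * (fps_X ^ n * gf_odd k h n)"
proof -
  have "gf k (SE, False, int h + 1) n = fps_X ^ n * gf_odd k h n"
    using gf_SE_False[of k "Suc h" n] by (simp add: add.commute)
  then show ?thesis
    by (subst gf_NE, simp, subst gf_odd_Suc)
      (auto simp del: power_Suc simp: algebra_simps)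
qed

lemma gf_odd_top:
  "gf_odd (Suc (Suc h)) h (Suc n) = fps_X ^ (2 * Suc n) * gf_odd (Suc (Suc h)) (h - 2) (Suc n)
    + fps_X ^ n * (1 + fps_X ^ Suc n) * gf_odd (Suc (Suc h)) h n"
  by (subst gf_odd_Suc, subst gf_NE_False) (simp add: algebra_simps)

text \<open>Substitution leaves the coefficient q^n + q^(2n+1) + q^(3n+1) + q^(4n+2) at
  \<open>gf_odd k h n\<close>, which factors as displayed.\<close>

lemma gf_odd_general:
  assumes "h + 2 < k"
  shows "(1 + fps_X ^ (4 * Suc n)) * gf_odd k h (Suc n) =
    fps_X ^ (2 * Suc n) * (gf_odd k (h - 2) (Suc n) + gf_odd k (h + 2) (Suc n))
    + fps_X ^ n * (1 + fps_X ^ Suc n) * (1 + fps_X ^ (2 * n + 1)) * gf_odd k h n"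
proof -
  have e: "fps_X ^ (4 * Suc n) = (fps_X ^ Suc n * fps_X ^ Suc n) * (fps_X ^ Suc n * fps_X ^ Suc n :: rat fps)"
    "fps_X ^ (2 * Suc n) = (fps_X ^ Suc n * fps_X ^ Suc n :: rat fps)"
    "fps_X ^ (2 * n + 1) = (fps_X ^ Suc n * fps_X ^ n :: rat fps)"
    by (simp_all only: power_add[symmetric]) (rule arg_cong[of _ _ "(^) fps_X"], simp)+
  have 1: "gf_odd k h (Suc n) = fps_X ^ (2 * Suc n) * gf_odd k (h - 2) (Suc n) +
    (fps_X ^ Suc n * gf k (NE, False, int h + 1) (Suc n) + fps_X ^ n * gf_odd k h n)"
    using assms by (subst gf_odd_Suc) simp
  have 2: "gf k (NE, False, int h + 1) (Suc n) = fps_X ^ Suc n * gf k (NE, True, int h + 2) (Suc n)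
       + fps_X ^ n * (fps_X ^ n * gf_odd k h n) + fps_X ^ n * gf_odd k h n"
    using assms gf_NE_False by simp
  have 3: "(1 + fps_X ^ (4 * Suc n)) * gf_odd k h (Suc n)
      = (fps_X ^ (2 * Suc n) * gf_odd k (h - 2) (Suc n) +
         (fps_X ^ Suc n * gf k (NE, False, int h + 1) (Suc n) + fps_X ^ n * gf_odd k h n))
        + fps_X ^ (4 * Suc n) * gf_odd k h (Suc n)"
    unfolding distrib_right mult_1_left by (rule arg_cong2[OF 1 refl])
  show ?thesis
    unfolding 3 unfolding 2 gf_NE_True unfolding e by algebra
qed

text \<open>The closed form of the product of q^i (1 + q^(i+1)) over i < n.\<close>

definition factor :: "nat \<Rightarrow> rat fps" where
  "factor n = fps_X ^ (n * (n - 1) div 2) * qpoch (- fps_X) fps_X n"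

lemma factor_0: "factor 0 = 1"
  by (simp add: factor_def qpoch_def)

lemma factor_Suc: "factor (Suc n) = fps_X ^ n * (1 + fps_X ^ Suc n) * factor n"
proof -
  have "Suc n * (Suc n - 1) div 2 = n + n * (n - 1) div 2"
    by (cases n) (simp_all add: algebra_simps)
  then show ?thesis
    by (simp add: factor_def qpoch_def power_add mult_ac)
qed

text \<open>Each equation writes \<open>d h\<close> as q^(2N) times a combination of values of
  \<open>d\<close>; as N is positive, every coefficient depends on lower ones only.\<close>

lemma recurrence_zero:
  fixes d :: "nat \<Rightarrow> rat fps"
  assumes N: "0 < N"
    and edge: "d J = fps_X ^ (2 * N) * d (J - 2)"
    and top: "\<And>h. J = h + 1 \<Longrightarrow> d h = fps_X ^ (2 * N) * d (h - 2)"
    and general: "\<And>h. h + 2 \<le> J \<Longrightarrow>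
      (1 + fps_X ^ (4 * N)) * d h = fps_X ^ (2 * N) * (d (h - 2) + d (h + 2))"
  shows "h \<le> J \<Longrightarrow> d h = 0"
proof -
  have "\<forall>h\<le>J. fps_nth (d h) m = 0" for m
  proof (induction m rule: less_induct)
    case (less m)
    have zero: "fps_nth (fps_X ^ (2 * N) * e) m = 0" if "\<And>j. j < m \<Longrightarrow> fps_nth e j = 0" for e :: "rat fps"
      using that N by (simp add: fps_X_power_mult_nth)
    show ?case
    proof (intro allI impI)
      fix h assume h: "h \<le> J"
      consider "h = J" | "J = h + 1" | "h + 2 \<le> J" using h by linarith
      then show "fps_nth (d h) m = 0"
      proof cases
        case 1
        then show ?thesis
          unfolding \<open>h = J\<close> by (subst edge, intro zero) (use less in auto)
      next
        case 2
        show ?thesis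
          by (subst top[OF 2], intro zero) (use less 2 in auto)
      next
        case 3
        have "fps_X ^ (4 * N) = fps_X ^ (2 * N) * (fps_X ^ (2 * N) :: rat fps)"
          by (simp flip: power_add)
        moreover have "d h = (1 + fps_X ^ (4 * N)) * d h - fps_X ^ (4 * N) * d h"
          by algebra
        ultimately have *: "d h = fps_X ^ (2 * N) * (d (h - 2) + d (h + 2) - fps_X ^ (2 * N) * d h)"
          unfolding general[OF 3] by (simp only: right_diff_distrib mult.assoc)
        show ?thesis
          by (subst *, intro zero) (use less 3 in \<open>auto simp: fps_X_power_mult_nth\<close>)
      qed
    qed
  qed
  then show "h \<le> J \<Longrightarrow> d h = 0"
    by (simp add: fps_eq_iff)
qed

text \<open>Both sides solve the same system at \<open>Suc n\<close>, whose inhomogeneous part lives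
  at level \<open>n\<close> and cancels in the difference by the induction hypothesis.\<close>

lemma gf_odd_eq_multisum: "h \<le> J \<Longrightarrow> gf_odd (Suc J) h n = factor n * multisum J h n"
proof (induction n arbitrary: h)
  case 0
  then show ?case by (simp add: gf_SE_0 factor_0)
next
  case (Suc n)
  define d where "d h = gf_odd (Suc J) h (Suc n) - factor (Suc n) * multisum J h (Suc n)" for h
  have "d h = 0"
  proof (rule recurrence_zero[of "Suc n" d J, OF _ _ _ _ Suc.prems])
    show "d J = fps_X ^ (2 * Suc n) * d (J - 2)"
      unfolding d_def gf_odd_edge multisum_edge[of J "Suc n"] by algebra
  next
    fix h assume J: "J = h + 1"
    then have IH: "gf_odd (Suc (Suc h)) h n = factor n * multisum (Suc h) h n"
      using Suc.IH[of h] by simp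
    have k: "J = Suc h" using J by simp
    show "d h = fps_X ^ (2 * Suc n) * d (h - 2)"
      unfolding d_def k gf_odd_top[of h n] multisum_top[of h n] factor_Suc IH by algebra
  next
    fix h assume h: "h + 2 \<le> J"
    then have IH: "gf_odd (Suc J) h n = factor n * multisum J h n"
      using Suc.IH[of h] by simp
    have "h + 2 < Suc J" using h by simp
    note step = gf_odd_general[OF this, of n] multisum_general[OF h, of n]
    have "(1 + fps_X ^ (4 * Suc n)) * d h = (1 + fps_X ^ (4 * Suc n)) * gf_odd (Suc J) h (Suc n)
        - factor (Suc n) * ((1 + fps_X ^ (4 * Suc n)) * multisum J h (Suc n))"
      unfolding d_def by algebra
    also have "\<dots> = fps_X ^ (2 * Suc n) * (d (h - 2) + d (h + 2))"
      unfolding step unfolding d_def IH factor_Suc by algebra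
    finally show "(1 + fps_X ^ (4 * Suc n)) * d h = fps_X ^ (2 * Suc n) * (d (h - 2) + d (h + 2))" .
  qed simp
  then show ?case by (simp add: d_def)
qed

text \<open>The forced step at position 0 leads to height k - a - 1 (to 0 if a = k) and contributes
  q^n. This power also shows that a word with \<open>n\<close> peaks has major index at least
  \<open>n\<close>, so the sum may stop at \<open>m\<close>.\<close>

lemma card_even_paths:
  assumes "1 \<le> a" "a \<le> k"
  shows "of_nat (H k a m) =
    fps_nth (\<Sum>n\<le>m. fps_X ^ n * (factor n * multisum (k - 1) (k - a - 1) n)) m"
proof -
  let ?st = "(SE, False, int (k - a)) :: state"
  have r: "reachable ?st" by (simp add: reachable_def)
  have gf: "gf k ?st n = fps_X ^ n * (factor n * multisum (k - 1) (k - a - 1) n)" for n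
    using gf_SE_False[of k "k - a" n] gf_odd_eq_multisum[of "k - a - 1" "k - 1" n] assms by simp
  have empty: "words k ?st n m = {}" if "m < n" for n
  proof -
    have "of_nat (card (words k ?st n m)) = fps_nth (gf k ?st n) m"
      by (simp add: gf_def)
    also have "\<dots> = 0"
      using that by (simp add: gf fps_X_power_mult_nth)
    finally show ?thesis
      using finite_words[OF r] by simp
  qed
  have "{P. lattice_path P \<and> special_conditions k a P \<and> major_index P = int m \<and>
        (\<forall>i. peak P i \<longrightarrow> even_peak P i)}
      = Pair (int k - int a) ` {w. admissible k ?st w \<and> major ?st w = m}" (is "?A = Pair _ ` ?B")
  proof (intro set_eqI iffI)
    fix P assume P: "P \<in> ?A"
    then have "P = (int k - int a, snd P)"
      by (cases P) (auto simp: special_conditions_def start_height_def)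
    then show "P \<in> Pair (int k - int a) ` ?B"
      using P admissible_words[OF assms, of "snd P"] major_index_eq[of "int k - int a" "snd P"] assms
      by (intro image_eqI[of _ _ "snd P"]) (auto simp: of_nat_diff)
  next
    fix P assume "P \<in> Pair (int k - int a) ` ?B"
    then show "P \<in> ?A"
      using admissible_words[OF assms] assms by (auto simp: of_nat_diff major_index_eq)
  qed
  then have "H k a m = card ?B"
    unfolding H_def by (simp add: card_image inj_on_def)
  also have "?B = (\<Union>n\<le>m. words k ?st n m)"
    using empty by (fastforce simp: words_def not_less[symmetric])
  also have "card \<dots> = (\<Sum>n\<le>m. card (words k ?st n m))"
    by (intro card_UN_disjoint) (auto simp: words_def intro!: finite_words[OF r, unfolded words_def])
  finally show ?thesis
    unfolding gf[symmetric] by (simp add: fps_sum_nth gf_def)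
qed

section \<open>Expanding the multiple series\<close>

text \<open>The squares start one index late because the exponent belonging to N_1 in the theorem is
  triangular and comes from elsewhere.\<close>

definition square_sum :: "nat \<Rightarrow> nat \<Rightarrow> (nat \<Rightarrow> nat) \<Rightarrow> nat" where
  "square_sum k s f = (\<Sum>i = Suc s..k - 1. (tail_sum k f i)\<^sup>2)"

definition linear_sum :: "nat \<Rightarrow> nat \<Rightarrow> (nat \<Rightarrow> nat) \<Rightarrow> nat" where
  "linear_sum k b f = (\<Sum>j | b + 2 * j \<le> k - 1. 2 * tail_sum k f (b + 2 * j))"

definition compositions :: "nat \<Rightarrow> nat \<Rightarrow> nat \<Rightarrow> (nat \<Rightarrow> nat) set" where
  "compositions k s n = {f \<in> {s..k - 1} \<rightarrow>\<^sub>E UNIV. tail_sum k f s = n}"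

lemma finite_compositions: "finite (compositions k s n)"
proof (rule finite_subset)
  show "compositions k s n \<subseteq> {s..k - 1} \<rightarrow>\<^sub>E {..n}"
  proof
    fix f assume f: "f \<in> compositions k s n"
    have "f i \<le> n" if "i \<in> {s..k - 1}" for i
      using f member_le_sum[of i "{s..k - 1}" f] that by (auto simp: compositions_def tail_sum_def)
    with f show "f \<in> {s..k - 1} \<rightarrow>\<^sub>E {..n}"
      by (auto simp: compositions_def PiE_iff)
  qed
qed (auto intro: finite_PiE)

lemma linear_sum_step: "b \<le> k - 1 \<Longrightarrow> linear_sum k b f = 2 * tail_sum k f b + linear_sum k (b + 2) f"
proof -
  assume b: "b \<le> k - 1"
  have *: "{j. b + 2 * j \<le> k - 1} = insert 0 (Suc ` {j. b + 2 + 2 * j \<le> k - 1})"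
  proof (intro set_eqI)
    fix j show "j \<in> {j. b + 2 * j \<le> k - 1} \<longleftrightarrow> j \<in> insert 0 (Suc ` {j. b + 2 + 2 * j \<le> k - 1})"
      using b by (cases j) auto
  qed
  have "finite {j. b + 2 + 2 * j \<le> k - 1}"
    by (rule finite_subset[of _ "{..k}"]) auto
  then show ?thesis
    unfolding linear_sum_def * by (simp add: sum.reindex)
qed

lemma linear_sum_empty: "k - 1 < b \<Longrightarrow> linear_sum k b f = 0"
  by (simp add: linear_sum_def)

text \<open>The new variable n_s = n - m is put in front of a composition of m. For
  \<open>h = Suc J\<close> the linear sum starts at s itself, and its first term 2 N_s = 2n is the
  prefactor in \<open>multisum\<close>.\<close>

lemma multisum_expand:
  "J < k \<Longrightarrow> h \<le> J \<Longrightarrow> multisum J h n =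
    (\<Sum>f\<in>compositions k (k - J) n. fps_X ^ (square_sum k (k - J) f + linear_sum k (k - h) f)
       * (\<Prod>i = k - J..k - 1. ipoch (f i)))"
proof (induction J arbitrary: h n)
  case 0
  then have "compositions k k n = (if n = 0 then {\<lambda>x. undefined} else {})"
    by (auto simp: compositions_def tail_sum_def)
  with 0 show ?case
    by (simp add: square_sum_def linear_sum_empty)
next
  case (Suc J)
  define s where "s = k - Suc J"
  have s: "k - J = Suc s" "s \<le> k - 1" "{s..k - 1} = insert s {Suc s..k - 1}"
    using Suc.prems by (auto simp: s_def)
  have upd: "tail_sum k (g(s := v)) i = tail_sum k g i" if "s < i" for g v i
    using that by (auto simp: tail_sum_def intro!: sum.cong)
  have tail_s: "tail_sum k f s = f s + tail_sum k f (Suc s)" for f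
    unfolding tail_sum_def by (rule sum.atLeast_Suc_atMost[OF s(2)])
  have sq: "square_sum k s f = (tail_sum k f (Suc s))\<^sup>2 + square_sum k (Suc s) f"  for f
  proof (cases "Suc s \<le> k - 1")
    case True
    then show ?thesis
      unfolding square_sum_def by (rule sum.atLeast_Suc_atMost)
  qed (simp add: square_sum_def tail_sum_def)
  have low: "bailey (multisum J h) n = (\<Sum>f\<in>compositions k s n.
      fps_X ^ (square_sum k s f + linear_sum k (k - h) f) * (\<Prod>i = s..k - 1. ipoch (f i)))"
    if h: "h \<le> J" for h
  proof -
    let ?F = "\<lambda>f. fps_X ^ (square_sum k (Suc s) f + linear_sum k (k - h) f)
       * (\<Prod>i = Suc s..k - 1. ipoch (f i))"
    have IH: "multisum J h m = sum ?F (compositions k (Suc s) m)" for m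
      using Suc.IH[OF _ h, of m] Suc.prems s(1) by simp
    have "bailey (multisum J h) n =
        (\<Sum>(m, g)\<in>(SIGMA m:{..n}. compositions k (Suc s) m). fps_X ^ m\<^sup>2 * ?F g * ipoch (n - m))"
      unfolding bailey_def IH sum_distrib_left sum_distrib_right
      by (subst sum.Sigma) (simp_all add: finite_compositions)
    also have "\<dots> = (\<Sum>f\<in>compositions k s n.
      fps_X ^ (square_sum k s f + linear_sum k (k - h) f) * (\<Prod>i = s..k - 1. ipoch (f i)))"
    proof (rule sum.reindex_bij_witness[where
          i = "\<lambda>f. (n - f s, f(s := undefined))" and j = "\<lambda>(m, g). g(s := n - m)"])
      fix x assume "x \<in> (SIGMA m:{..n}. compositions k (Suc s) m)"
      then obtain m g where x: "x = (m, g)" "m \<le> n" "g \<in> {Suc s..k - 1} \<rightarrow>\<^sub>E UNIV"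
          "tail_sum k g (Suc s) = m"
        by (auto simp: compositions_def)
      then have gs: "g s = undefined" by (auto simp: PiE_iff extensional_def)
      with x show "(n - (case x of (m, g) \<Rightarrow> g(s := n - m)) s, (case x of (m, g) \<Rightarrow> g(s := n - m))(s := undefined)) = x"
        by (auto simp: fun_eq_iff)
      show "(case x of (m, g) \<Rightarrow> g(s := n - m)) \<in> compositions k s n"
      proof -
        have "g(s := n - m) \<in> {s..k - 1} \<rightarrow>\<^sub>E UNIV"
          unfolding s(3) using x(3) by (intro PiE_fun_upd) auto
        then show ?thesis
          using x by (simp add: compositions_def tail_s upd)
      qed
      \<comment> \<open>From \<open>h <= J\<close> follows k - h > s, so no tail sum in it reaches
        the new variable.\<close>
      have lin: "linear_sum k (k - h) (g(s := n - m)) = linear_sum k (k - h) g"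
        unfolding linear_sum_def using h s(1) by (intro sum.cong) (auto simp: upd)
      have sq': "square_sum k (Suc s) (g(s := n - m)) = square_sum k (Suc s) g"
        unfolding square_sum_def by (intro sum.cong) (auto simp: upd)
      have "(\<Prod>i = s..k - 1. ipoch ((g(s := n - m)) i)) = ipoch (n - m) * (\<Prod>i = Suc s..k - 1. ipoch (g i))"
      proof -
        have "(\<Prod>i = Suc s..k - 1. ipoch ((g(s := n - m)) i)) = (\<Prod>i = Suc s..k - 1. ipoch (g i))"
          by (intro prod.cong) auto
        then show ?thesis unfolding s(3) by simp
      qed
      then show "fps_X ^ (square_sum k s (case x of (m, g) \<Rightarrow> g(s := n - m)) + linear_sum k (k - h) (case x of (m, g) \<Rightarrow> g(s := n - m)))
            * (\<Prod>i = s..k - 1. ipoch ((case x of (m, g) \<Rightarrow> g(s := n - m)) i)) =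
          (case x of (m, g) \<Rightarrow> fps_X ^ m\<^sup>2 * ?F g * ipoch (n - m))"
        by (simp add: x sq sq' lin upd power_add mult_ac)
    next
      fix f assume f: "f \<in> compositions k s n"
      then have n: "n = f s + tail_sum k f (Suc s)"
        by (auto simp: compositions_def tail_s)
      then show "(case (n - f s, f(s := undefined)) of (m, g) \<Rightarrow> g(s := n - m)) = f"
        by (auto simp: fun_eq_iff)
      show "(n - f s, f(s := undefined)) \<in> (SIGMA m:{..n}. compositions k (Suc s) m)"
        using f n by (auto simp: compositions_def upd s(3) PiE_iff extensional_def)
    qed
    finally show ?thesis .
  qed
  show ?case
  proof (cases "h \<le> J")
    case True
    then show ?thesis using low by (simp add: s_def)
  next
    case False
    with Suc.prems have h: "h = Suc J" by simp
    have lin: "linear_sum k s f = 2 * tail_sum k f s + linear_sum k (k - (h - 2)) f" for f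
    \<comment> \<open>For J = 0 the subtraction \<open>h - 2\<close> truncates, so the start k
      replaces s + 2 = k + 1; both lie beyond k - 1.\<close>
    proof (cases "J = 0")
      case True
      then show ?thesis
        using linear_sum_step[OF s(2), of f] s h by (simp add: linear_sum_empty s_def)
    next
      case False
      then have "k - (h - 2) = s + 2"
        using h Suc.prems by (simp add: s_def)
      then show ?thesis
        using linear_sum_step[OF s(2), of f] by simp
    qed
    have "multisum (Suc J) h n = fps_X ^ (2 * n) * bailey (multisum J (h - 2)) n"
      by (simp add: h)
    also have "\<dots> = (\<Sum>f\<in>compositions k s n.
      fps_X ^ (square_sum k s f + linear_sum k (k - h) f) * (\<Prod>i = s..k - 1. ipoch (f i)))"
    proof -
      have "h - 2 \<le> J" "k - h = s" using h by (auto simp: s_def)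
      then show ?thesis
        unfolding low[OF \<open>h - 2 \<le> J\<close>] sum_distrib_left
        by (intro sum.cong) (auto simp: lin compositions_def power_add mult_ac)
    qed
    finally show ?thesis by (simp add: s_def)
  qed
qed

text \<open>A neighbourhood of a power series contains all series that agree with it up to some
  order, so it suffices that the coefficients become stationary.\<close>

lemma fps_has_sumI:
  fixes f :: "'a \<Rightarrow> 'b::comm_ring_1 fps"
  assumes "\<And>m. \<exists>F. finite F \<and> F \<subseteq> A \<and> (\<forall>G. finite G \<longrightarrow> F \<subseteq> G \<longrightarrow> G \<subseteq> A \<longrightarrow>
    (\<forall>j\<le>m. fps_nth (sum f G) j = fps_nth s j))"
  shows "(f has_sum s) A"
  unfolding has_sum_def
proof (rule topological_tendstoI)
  fix S assume "open S" "s \<in> S"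
  then obtain m where m: "{G. fps_cutoff m G = fps_cutoff m s} \<subseteq> S"
    unfolding open_fps_iff by blast
  from assms[of m] obtain F where "finite F \<and> F \<subseteq> A \<and> (\<forall>G. finite G \<longrightarrow> F \<subseteq> G \<longrightarrow> G \<subseteq> A \<longrightarrow>
    (\<forall>j\<le>m. fps_nth (sum f G) j = fps_nth s j))" ..
  then have F: "finite F" "F \<subseteq> A" "\<And>G j. finite G \<Longrightarrow> F \<subseteq> G \<Longrightarrow> G \<subseteq> A \<Longrightarrow> j \<le> m \<Longrightarrow>
      fps_nth (sum f G) j = fps_nth s j"
    by simp_all
  show "\<forall>\<^sub>F G in finite_subsets_at_top A. sum f G \<in> S"
    unfolding eventually_finite_subsets_at_top
  proof (intro exI[of _ F] conjI allI impI F)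
    fix G assume "finite G \<and> F \<subseteq> G \<and> G \<subseteq> A"
    then have "fps_cutoff m (sum f G) = fps_cutoff m s"
      using F(3)[of G] by (simp add: fps_eq_iff)
    with m show "sum f G \<in> S" by blast
  qed
qed

lemma inverse_prod_fps:
  "finite A \<Longrightarrow> inverse (\<Prod>i\<in>A. f i) = (\<Prod>i\<in>A. inverse (f i :: 'a::field fps))"
  by (induction A rule: finite_induct) (simp_all add: fps_inverse_mult)

theorem theorem1p5:
  fixes k a :: nat
  assumes "1 \<le> a" and "a \<le> k"
  defines "q \<equiv> (fps_X :: rat fps)"
  defines "N \<equiv> tail_sum k"
  shows "((\<lambda>n. q ^ (N n 1 * (N n 1 + 1) div 2 + (\<Sum>i = 2..k - 1. (N n i)\<^sup>2)
                     + (\<Sum>j | a + 1 + 2 * j \<le> k - 1. 2 * N n (a + 1 + 2 * j)))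
               * qpoch (- q) q (N n 1)
               * inverse (\<Prod>i = 1..k - 1. qpoch (q\<^sup>2) (q\<^sup>2) (n i)))
          has_sum Abs_fps (\<lambda>m. of_nat (H k a m)))
         ({1..k - 1} \<rightarrow>\<^sub>E (UNIV :: nat set))"
proof -
  define T where "T n = q ^ (N n 1 * (N n 1 + 1) div 2 + (\<Sum>i = 2..k - 1. (N n i)\<^sup>2)
                     + (\<Sum>j | a + 1 + 2 * j \<le> k - 1. 2 * N n (a + 1 + 2 * j)))
               * qpoch (- q) q (N n 1)
               * inverse (\<Prod>i = 1..k - 1. qpoch (q\<^sup>2) (q\<^sup>2) (n i))" for n
  define U where "U r = fps_X ^ r * (factor r * multisum (k - 1) (k - a - 1) r)" for r
  have lin: "linear_sum k (k - (k - a - 1)) n = (\<Sum>j | a + 1 + 2 * j \<le> k - 1. 2 * N n (a + 1 + 2 * j))" for n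
  proof (cases "a = k")
    case False
    then have "k - (k - a - 1) = a + 1" using assms by simp
    then show ?thesis by (simp add: linear_sum_def N_def)
  next
    \<comment> \<open>Here k - a - 1 truncates to 0 and the start index is k instead of a + 1; both
      linear sums are empty.\<close>
    case True
    then have "{j. a + 1 + 2 * j \<le> k - 1} = {}" using assms by auto
    with True assms(1) show ?thesis by (simp add: linear_sum_empty)
  qed
  have T: "T n = fps_X ^ N n 1 * (factor (N n 1) *
      (fps_X ^ (square_sum k 1 n + linear_sum k (k - (k - a - 1)) n) * (\<Prod>i = 1..k - 1. ipoch (n i))))" for n
  proof -
    have "N n 1 * (N n 1 + 1) div 2 = N n 1 + N n 1 * (N n 1 - 1) div 2"
      by (cases "N n 1") (simp_all add: algebra_simps)
    then show ?thesis
      unfolding T_def factor_def lin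
      by (simp add: q_def square_sum_def N_def ipoch_def inverse_prod_fps power_add mult_ac numeral_2_eq_2)
  qed
  have sum_T: "sum T (compositions k 1 r) = U r" for r
  proof -
    have k: "k - 1 < k" "k - (k - 1) = 1" "k - a - 1 \<le> k - 1" using assms by auto
    show ?thesis
      unfolding U_def multisum_expand[OF k(1,3)] sum_distrib_left k(2) T
      by (intro sum.cong) (auto simp: compositions_def N_def)
  qed
  show ?thesis
    unfolding T_def[symmetric]
  proof (intro fps_has_sumI exI conjI allI impI)
    fix m :: nat
    let ?A = "{1..k - 1} \<rightarrow>\<^sub>E (UNIV :: nat set)"
    let ?F = "\<Union>r\<le>m. compositions k 1 r"
    show "finite ?F" by (simp add: finite_compositions)
    show "?F \<subseteq> ?A" by (auto simp: compositions_def)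
    fix G j assume G: "finite G" "?F \<subseteq> G" "G \<subseteq> ?A" and j: "j \<le> m"
    \<comment> \<open>Outside \<open>?F\<close> the tail sum N_1 exceeds m, and q^(N_1) divides the
      term.\<close>
    have "fps_nth (T n) j = 0" if "n \<in> G - ?F" for n
    proof -
      have "m < N n 1"
        using that G by (force simp: compositions_def N_def not_le[symmetric])
      then show ?thesis using j unfolding T by (simp add: fps_X_power_mult_nth)
    qed
    then have "fps_nth (sum T G) j = fps_nth (sum T ?F) j"
      unfolding fps_sum_nth by (intro sum.mono_neutral_right G) auto
    also have "sum T ?F = (\<Sum>r\<le>m. U r)"
      unfolding sum_T[symmetric]
      by (intro sum.UNION_disjoint) (auto simp: finite_compositions, auto simp: compositions_def)
    also have "fps_nth \<dots> j = fps_nth (\<Sum>r\<le>j. U r) j"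
      unfolding fps_sum_nth using j
      by (intro sum.mono_neutral_right) (auto simp: U_def fps_X_power_mult_nth)
    also have "\<dots> = fps_nth (Abs_fps (\<lambda>m. of_nat (H k a m))) j"
      using card_even_paths[OF assms(1,2), of j] by (simp add: U_def)
    finally show "fps_nth (sum T G) j = fps_nth (Abs_fps (\<lambda>m. of_nat (H k a m))) j" .
  qed
qed

end
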